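(* Assume that $\lambda>0$ and $\lambda>\frac{e^{-1}}{V}\left(1-\frac{\gamma^2}{V^2}\right)$. There exists $u>0$ such that for every maximal solution $z(t)$ in $H$ of the differential equation $z'(t)=F(\phi(z(t)))$ with $z(0)\in C_u$: (i) if $\lambda<e^{-1}/V$, then $z(c)=0$ for some $c>0$ (that is, $z(t)\to0$ as $t\uparrow c$ for some finite $c>0$); (ii) if $\lambda>e^{-1}/V$, then $z(t)\sim(\lambda-e^{-1}/V)\,t\,\mathbf 1$ as $t\to\infty$, i.e. $z_i(t)/t\to\lambda-e^{-1}/V$ for every $i=1,\dots,K$.
   Context: $\mathcal G$ is a connected undirected graph on the vertex set $\{1,\dots,K\}$, $K\ge2$, in which every closed neighbourhood $V_i=\{i\}\cup\{j: j\text{ adjacent to }i\}$ has the same cardinality $V$. $A$ is the symmetric $K\times K$ matrix with $A_{ij}=1$ if $j\in V_i$ and $A_{ij}=0$ otherwise (adjacency matrix with ones on the diagonal); its eigenvalues are $\nu_1\le\dots\le\nu_K$, with $\nu_K=V$, and $\gamma=\min_{i<K}(\nu_K-\nu_i)=\nu_K-\nu_{K-1}$ is the spectral gap. $H=\{x\in\mathbb R^K:x_i>0\text{ for all }i\}$; $\mathbf 1=(1,\dots,1)$; $|x|=\sum_k|x_k|$; $C_u=\{x\in H:\bigl|x/|x|-\mathbf 1/K\bigr|\le u\}$. For $x\in H$, $\phi_i(x)=x_i/\sum_{j\in V_i}x_j$, $\phi=(\phi_1,\dots,\phi_K)$, and $F_i(x)=\lambda-x_ie^{-\sum_{j\in V_i}x_j}$,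 $F=(F_1,\dots,F_K)$. *)

theory Defs
  imports "HOL-Analysis.Analysis" "HOL-Computational_Algebra.Polynomial"
begin

text \<open>An undirected simple graph on the vertex type \<open>'n\<close> is given by its symmetric,
  irreflexive edge relation \<open>E\<close>.\<close>

definition closed_nbhd :: "('n \<times> 'n) set \<Rightarrow> 'n \<Rightarrow> 'n set" where
  "closed_nbhd E i = insert i {j. (i, j) \<in> E}"

definition nbhd_matrix :: "('n \<times> 'n) set \<Rightarrow> real ^ 'n ^ 'n" where
  "nbhd_matrix E = (\<chi> i j. if j \<in> closed_nbhd E i then 1 else 0)"

definition char_poly :: "real ^ 'n ^ 'n \<Rightarrow> real poly" where
  "char_poly M = det (\<chi> i j. (if i = j then [:0, 1:] else 0) - [:M $ i $ j:])"

text \<open>The real eigenvalues in increasing order, repeated according to algebraic multiplicity.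
  For a symmetric matrix the list has length \<open>CARD('n)\<close>.\<close>

definition eigenvalue_list :: "real ^ 'n ^ 'n \<Rightarrow> real list" where
  "eigenvalue_list M = sorted_list_of_multiset (proots (char_poly M))"

text \<open>List indices start at 0, so this is \<open>\<nu>\<^sub>K - \<nu>\<^sub>K\<^sub>-\<^sub>1\<close>; it vanishes when
  the largest eigenvalue is not simple. Meant for symmetric \<open>M\<close> and \<open>CARD('n) \<ge> 2\<close>.\<close>

definition spectral_gap :: "real ^ 'n ^ 'n \<Rightarrow> real" where
  "spectral_gap M =
     eigenvalue_list M ! (CARD('n) - 1) - eigenvalue_list M ! (CARD('n) - 2)"

definition pos_orthant :: "(real ^ 'n) set" where
  "pos_orthant = {x. \<forall>i. x $ i > 0}"

text \<open>The library \<open>norm\<close> on \<open>real ^ 'n\<close> is Euclidean.\<close>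

definition l1_norm :: "real ^ 'n \<Rightarrow> real" where
  "l1_norm x = (\<Sum>k\<in>UNIV. \<bar>x $ k\<bar>)"

definition cone_nbhd :: "real \<Rightarrow> (real ^ 'n) set" where
  "cone_nbhd u = {x \<in> pos_orthant.
     l1_norm ((1 / l1_norm x) *\<^sub>R x - (\<chi> i. 1 / real CARD('n))) \<le> u}"

definition phi :: "('n \<times> 'n) set \<Rightarrow> real ^ 'n \<Rightarrow> real ^ 'n" where
  "phi E x = (\<chi> i. x $ i / (\<Sum>j\<in>closed_nbhd E i. x $ j))"

definition drift :: "('n \<times> 'n) set \<Rightarrow> real \<Rightarrow> real ^ 'n \<Rightarrow> real ^ 'n" where
  "drift E lam x = (\<chi> i. lam - x $ i * exp (- (\<Sum>j\<in>closed_nbhd E i. x $ j)))"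

text \<open>Forward solutions, from time 0, of the autonomous equation \<open>z' = f z\<close> staying in \<open>S\<close>;
  only the values of \<open>z\<close> on \<open>I\<close> matter. Derivatives at endpoints belonging to \<open>I\<close> are one-sided.\<close>

definition solution_on ::
  "('a::real_normed_vector \<Rightarrow> 'a) \<Rightarrow> 'a set \<Rightarrow> real set \<Rightarrow> (real \<Rightarrow> 'a) \<Rightarrow> bool" where
  "solution_on f S I z \<longleftrightarrow> is_interval I \<and> 0 \<in> I \<and> I \<subseteq> {0..} \<and>
     (\<forall>t\<in>I. z t \<in> S \<and> (z has_vector_derivative f (z t)) (at t within I))"

definition maximal_solution_on ::
  "('a::real_normed_vector \<Rightarrow> 'a) \<Rightarrow> 'a set \<Rightarrow> real set \<Rightarrow> (real \<Rightarrow> 'a) \<Rightarrow> bool" where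
  "maximal_solution_on f S I z \<longleftrightarrow> solution_on f S I z \<and>
     (\<forall>J w. solution_on f S J w \<and> I \<subseteq> J \<and> (\<forall>t\<in>I. w t = z t) \<longrightarrow> J = I)"

end

theory Submission
  imports Defs "HOL-Computational_Algebra.Fundamental_Theorem_Algebra"
begin

text \<open>The field \<open>G = F \<circ> \<phi>\<close> is homogeneous of degree 0, with \<open>G 1 = \<beta> 1\<close>, \<open>\<beta> = \<lambda> - a\<close>, \<open>a = e\<^sup>-\<^sup>1 / V\<close>,
  and its derivative at \<open>1\<close> is \<open>- a (Id - A / V)\<^sup>2\<close>. Write a solution as \<open>z = r (1 + y)\<close>, where \<open>r\<close> is the mean
  of the coordinates and \<open>y\<close> is orthogonal to \<open>1\<close>. Then \<open>r' = \<beta> + o(1)\<close> as \<open>y \<rightarrow> 0\<close>, and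
  \<open>W = \<bar>y\<bar>\<^sup>2\<close> satisfies \<open>W' \<le> - (\<delta> / r) W\<close> while \<open>y\<close> is small, where
  \<open>\<delta> = \<lambda> - a (1 - \<gamma>\<^sup>2 / V\<^sup>2)\<close> is positive by assumption; this uses that
  \<open>\<bar>(V - A) y\<bar> \<ge> \<gamma> \<bar>y\<bar>\<close> on the orthogonal complement of \<open>1\<close>.
  Hence \<open>y\<close> stays small. If \<open>\<beta> < 0\<close>, then \<open>r\<close> hits 0 in finite time, and the whole vector with it.
  If \<open>\<beta> > 0\<close>, then \<open>r\<close> grows linearly, \<open>W r\<^sup>p\<close> decreases for small \<open>p > 0\<close>, so \<open>y \<rightarrow> 0\<close> and \<open>z' \<rightarrow> \<beta> 1\<close>.\<close>


section \<open>Eigenvalues of real symmetric matrices\<close>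

text \<open>In the Leibniz expansion the term of \<open>p\<close> has degree at most the number of
  fixed points of \<open>p\<close>, so only the identity reaches the coefficient at
  \<open>CARD('n)\<close>, and it contributes 1. Nonvanishing matters because \<open>proots\<close>
  is empty for the zero polynomial by convention.\<close>

lemma degree_char_poly:
  fixes M :: "real ^ 'n::finite ^ 'n"
  shows "degree (char_poly M) = CARD('n)" "char_poly M \<noteq> 0"
proof -
  define e where "e i j = (if i = j then [:0, 1:] else 0) - [:M $ i $ j:]" for i j
  define T where "T p = of_int (sign p) * (\<Prod>i\<in>UNIV. e i (p i))" for p :: "'n \<Rightarrow> 'n"
  let ?P = "{p. p permutes (UNIV :: 'n set)}"
  have char: "char_poly M = (\<Sum>p\<in>?P. T p)"
    unfolding char_poly_def det_def T_def e_def by simp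
  have deg_e: "degree (e i j) \<le> (if i = j then 1 else 0)" for i j
    by (auto simp: e_def)
  have deg_T: "degree (T p) \<le> card {i. p i = i}" for p
  proof -
    have "degree (T p) \<le> degree (\<Prod>i\<in>UNIV. e i (p i))"
      unfolding T_def using degree_mult_le[of "of_int (sign p)" "\<Prod>i\<in>UNIV. e i (p i)"]
      by simp
    also have "\<dots> \<le> (\<Sum>i\<in>UNIV. degree (e i (p i)))"
      using degree_prod_sum_le[of UNIV "\<lambda>i. e i (p i)"] by (simp add: o_def)
    also have "\<dots> \<le> (\<Sum>i\<in>UNIV. if p i = i then 1 else 0)"
      by (rule sum_mono) (use deg_e in \<open>force split: if_splits\<close>)
    also have "\<dots> = card {i. p i = i}" by (simp add: sum.If_cases)
    finally show ?thesis .
  qed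
  have coeff_T: "coeff (T p) CARD('n) = (if p = id then 1 else 0)" for p
  proof (cases "p = id")
    case True
    have "e i i = [:- M $ i $ i, 1:]" for i by (simp add: e_def)
    then have "T p = (\<Prod>i\<in>UNIV. [:- M $ i $ i, 1:])" by (simp add: T_def True sign_id)
    moreover have "degree (\<Prod>i\<in>(UNIV::'n set). [:- M $ i $ i, 1:]) = CARD('n)"
      by (subst degree_prod_eq_sum_degree) auto
    moreover have "lead_coeff (\<Prod>i\<in>(UNIV::'n set). [:- M $ i $ i, 1:]) = 1"
      by (subst lead_coeff_prod) auto
    ultimately show ?thesis using True by simp
  next
    case False
    then have "{i. p i = i} \<subset> UNIV" by (auto simp: fun_eq_iff)
    then have "card {i. p i = i} < CARD('n)" by (intro psubset_card_mono) auto
    with deg_T[of p] have "degree (T p) < CARD('n)" by simp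
    with False show ?thesis by (simp add: coeff_eq_0)
  qed
  have "degree (char_poly M) \<le> CARD('n)"
    unfolding char
  proof (rule degree_sum_le)
    show "degree (T p) \<le> CARD('n)" for p
      using deg_T[of p] card_mono[of UNIV "{i. p i = i}"]
      by (meson finite_UNIV finite_class.finite_UNIV le_trans subset_UNIV)
  qed (simp add: finite_permutations)
  moreover have c: "coeff (char_poly M) CARD('n) = 1"
    by (simp add: char coeff_sum coeff_T finite_permutations permutes_id)
  ultimately show "degree (char_poly M) = CARD('n)"
    using le_degree[of "char_poly M" "CARD('n)"] by (metis le_antisym one_neq_zero)
  show "char_poly M \<noteq> 0" using c by auto
qed

section \<open>Complexification and reality of the roots\<close>

lemma map_poly_of_real_mult:
  "map_poly (of_real :: real \<Rightarrow> complex) (p * q) = map_poly of_real p * map_poly of_real q"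
  by (rule poly_eqI) (simp add: coeff_map_poly coeff_mult)

lemma map_poly_of_real_prod:
  "map_poly (of_real :: real \<Rightarrow> complex) (prod f A) = (\<Prod>i\<in>A. map_poly of_real (f i))"
  by (induction A rule: infinite_finite_induct)
     (auto simp: map_poly_of_real_mult map_poly_1)

lemma map_poly_of_real_sum:
  "map_poly (of_real :: real \<Rightarrow> complex) (sum f A) = (\<Sum>i\<in>A. map_poly of_real (f i))"
  by (rule poly_eqI) (simp add: coeff_map_poly coeff_sum)

lemma poly_map_poly_of_real:
  "poly (map_poly of_real p) (of_real x :: complex) = of_real (poly p x)"
  by (induction p) (auto simp: map_poly_pCons)

lemma det_eq_0_iff_kernel:
  fixes N :: "'a::field ^ 'n::finite ^ 'n"
  shows "det N = 0 \<longleftrightarrow> (\<exists>v. v \<noteq> 0 \<and> N *v v = 0)"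
  using invertible_det_nz[of N] matrix_left_invertible_ker[of N] invertible_left_inverse[of N]
  by blast

lemma poly_char_poly:
  "poly (char_poly M) x = det (\<chi> i j. (if i = j then x else 0) - M $ i $ j)"
  unfolding char_poly_def det_def
  by (simp add: poly_sum poly_prod if_distrib[of "\<lambda>p. poly p x"] cong: if_cong)

text \<open>Turns a complex root of the real polynomial into a singular complex matrix, so that a
  complex eigenvector becomes available. The coercion is pushed through the Leibniz formula entry by
  entry.\<close>

lemma poly_map_poly_char_poly:
  "poly (map_poly of_real (char_poly M)) (x :: complex) =
     det (\<chi> i j. (if i = j then x else 0) - of_real (M $ i $ j))"
proof -
  have sgn: "map_poly of_real (of_int k) = (of_int k :: complex poly)" for k
    by (rule poly_eqI) (simp add: coeff_map_poly of_int_poly coeff_pCons split: nat.splits)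
  have e: "map_poly of_real ((if P then [:0, 1:] else 0) - [:c:]) =
    (if P then [:0, 1:] else 0) - [:of_real c :: complex:]" for P c
    by (rule poly_eqI) (auto simp: coeff_map_poly coeff_pCons split: nat.splits)
  have p_e: "poly ((if P then [:0, 1:] else 0) - [:c:]) x = (if P then x else 0) - c" for P c
    by simp
  have p_sgn: "poly (of_int k) x = of_int k" for k
    by simp
  show ?thesis
    unfolding char_poly_def det_def
    by (simp only: map_poly_of_real_sum map_poly_of_real_mult map_poly_of_real_prod sgn e
      poly_sum poly_prod poly_mult p_e p_sgn vec_lambda_beta)
qed

text \<open>Stated over a commutative ring because it serves the real matrix and its
  complexification alike.\<close>

lemma shifted_matrix_mult_vec:
  fixes M :: "'a::comm_ring_1 ^ 'n::finite ^ 'n"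
  shows "(\<chi> i j. (if i = j then x else 0) - M $ i $ j) *v v = x *s v - M *v v"
proof -
  have "((if i = j then x else 0) - M $ i $ j) * v $ j =
    (if i = j then x * v $ j else 0) - M $ i $ j * v $ j" for i j
    by (auto simp: left_diff_distrib)
  then show ?thesis
    by (simp add: vec_eq_iff matrix_vector_mult_def sum_subtractf)
qed

lemma char_poly_root_iff:
  "poly (char_poly M) x = 0 \<longleftrightarrow> (\<exists>v. v \<noteq> 0 \<and> M *v v = x *\<^sub>R v)"
  unfolding poly_char_poly det_eq_0_iff_kernel shifted_matrix_mult_vec scalar_mult_eq_scaleR
  by (metis eq_iff_diff_eq_0)

text \<open>The Hermitian argument: for an eigenvector \<open>v\<close> with squared length
  \<open>N\<close>, the number \<open>z * N\<close> is the value of a quadratic form that symmetry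
  of \<open>M\<close> makes invariant under conjugation, and \<open>N\<close> is real and
  nonzero.\<close>

lemma symmetric_char_poly_root_real:
  fixes M :: "real ^ 'n::finite ^ 'n"
  assumes sym: "\<And>i j. M $ i $ j = M $ j $ i"
    and root: "poly (map_poly of_real (char_poly M)) (z :: complex) = 0"
  shows "z \<in> \<real>"
proof -
  from root obtain v :: "complex ^ 'n" where v: "v \<noteq> 0"
    and ker: "(\<chi> i j. (if i = j then z else 0) - of_real (M $ i $ j)) *v v = 0"
    unfolding poly_map_poly_char_poly det_eq_0_iff_kernel by blast
  have eig: "z * v $ i = (\<Sum>j\<in>UNIV. of_real (M $ i $ j) * v $ j)" for i
  proof -
    have "z *s v - (\<chi> i j. of_real (M $ i $ j)) *v v = 0"
      using ker shifted_matrix_mult_vec[of z "\<chi> i j. of_real (M $ i $ j)" v] by simp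
    then show ?thesis by (simp add: vec_eq_iff matrix_vector_mult_def)
  qed
  define N where "N = (\<Sum>i\<in>UNIV. cnj (v $ i) * v $ i)"
  have N_eq: "N = of_real (\<Sum>i\<in>UNIV. (cmod (v $ i))\<^sup>2)"
    unfolding N_def of_real_sum
    by (rule sum.cong[OF refl]) (metis complex_norm_square mult.commute)
  have "(\<Sum>i\<in>UNIV. (cmod (v $ i))\<^sup>2) \<noteq> 0"
    using v by (subst sum_nonneg_eq_0_iff) (auto simp: vec_eq_iff)
  then have N0: "N \<noteq> 0" unfolding N_eq by (metis of_real_eq_0_iff)
  have cN: "cnj N = N" unfolding N_eq by simp
  have zN: "z * N = (\<Sum>i\<in>UNIV. \<Sum>j\<in>UNIV. of_real (M $ i $ j) * cnj (v $ i) * v $ j)"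
    unfolding N_def sum_distrib_left
  proof (rule sum.cong[OF refl])
    fix i
    have "z * (cnj (v $ i) * v $ i) = cnj (v $ i) * (z * v $ i)" by (simp add: mult_ac)
    also have "\<dots> = (\<Sum>j\<in>UNIV. of_real (M $ i $ j) * cnj (v $ i) * v $ j)"
      unfolding eig sum_distrib_left by (simp add: mult_ac)
    finally show "z * (cnj (v $ i) * v $ i) =
      (\<Sum>j\<in>UNIV. of_real (M $ i $ j) * cnj (v $ i) * v $ j)" .
  qed
  have "cnj (z * N) = (\<Sum>i\<in>UNIV. \<Sum>j\<in>UNIV. of_real (M $ i $ j) * v $ i * cnj (v $ j))"
    unfolding zN by simp
  also have "\<dots> = (\<Sum>j\<in>UNIV. \<Sum>i\<in>UNIV. of_real (M $ i $ j) * v $ i * cnj (v $ j))"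
    by (rule sum.swap)
  also have "\<dots> = z * N" unfolding zN
    by (intro sum.cong refl) (metis sym mult.assoc mult.commute)
  finally have "cnj z = z" using cN N0 by simp
  then show ?thesis by (simp add: Reals_cnj_iff)
qed

text \<open>Induction on the degree: the fundamental theorem of algebra supplies a complex root,
  which is real by hypothesis, and its linear factor is split off over the reals.\<close>

lemma size_proots_real_rooted:
  fixes p :: "real poly"
  assumes "p \<noteq> 0" and "\<And>z :: complex. poly (map_poly of_real p) z = 0 \<Longrightarrow> z \<in> \<real>"
  shows "size (proots p) = degree p"
  using assms
proof (induction "degree p" arbitrary: p)
  case 0
  then show ?case using size_proots_le[of p] by simp
next
  case (Suc n)
  have dm: "degree (map_poly complex_of_real p) = degree p"
    by (simp add: degree_map_poly)
  have "\<not> constant (poly (map_poly complex_of_real p))"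
    using Suc.hyps(2) by (simp add: constant_degree dm)
  then obtain z where z: "poly (map_poly complex_of_real p) z = 0"
    using fundamental_theorem_of_algebra by blast
  then obtain x where x: "z = of_real x" using Suc.prems(2) Reals_cases by blast
  have "poly p x = 0" using z unfolding x by (simp add: poly_map_poly_of_real)
  then obtain q where q: "p = [:-x, 1:] * q" using poly_eq_0_iff_dvd dvd_def by blast
  with Suc.prems(1) have q0: "q \<noteq> 0" by auto
  have dq: "degree p = Suc (degree q)" unfolding q using q0 by (subst degree_mult_eq) auto
  have "size (proots q) = degree q"
  proof (rule Suc.hyps(1))
    show "n = degree q" using Suc.hyps(2) dq by simp
    show "w \<in> \<real>" if "poly (map_poly of_real q) w = 0" for w :: complex
      using Suc.prems(2)[of w] that unfolding q map_poly_of_real_mult by simp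
  qed (rule q0)
  then show ?case unfolding dq using q0 by (simp add: q proots_mult del: mult_pCons_left)
qed

text \<open>If the list were shorter, the indexing in \<^const>\<open>spectral_gap\<close> would return junk values;
  this is why the roots have to be shown real.\<close>

lemma length_eigenvalue_list:
  fixes M :: "real ^ 'n::finite ^ 'n"
  assumes "\<And>i j. M $ i $ j = M $ j $ i"
  shows "length (eigenvalue_list M) = CARD('n)"
proof -
  have "length (eigenvalue_list M) = size (mset (eigenvalue_list M))" by simp
  also have "\<dots> = size (proots (char_poly M))" by (simp add: eigenvalue_list_def)
  also have "\<dots> = CARD('n)"
    using size_proots_real_rooted[OF degree_char_poly(2)[of M] symmetric_char_poly_root_real[OF assms]]
    by (simp only: degree_char_poly(1))
  finally show ?thesis .
qed

lemma set_eigenvalue_list: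
  "x \<in> set (eigenvalue_list M) \<longleftrightarrow> (\<exists>v. v \<noteq> 0 \<and> M *v v = x *\<^sub>R v)"
proof -
  have "set (eigenvalue_list M) = set_mset (mset (eigenvalue_list M))" by simp
  also have "\<dots> = set_mset (proots (char_poly M))" by (simp add: eigenvalue_list_def)
  also have "\<dots> = {x. poly (char_poly M) x = 0}"
    using degree_char_poly(2)[of M] by simp
  finally show ?thesis by (simp add: char_poly_root_iff)
qed


section \<open>The spectral gap of a connected regular graph\<close>

text \<open>The first-order condition at a minimum, in algebraic form; it replaces differentiation
  in the variational argument for the Rayleigh quotient.\<close>

lemma nonneg_quadratic_imp_linear_zero:
  fixes b c :: real
  assumes "\<And>t. 0 \<le> 2 * t * b + t\<^sup>2 * c"
  shows "b = 0"
proof (rule ccontr)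
  assume b: "b \<noteq> 0"
  \<comment> \<open>With \<open>d\<close> positive and above \<open>c\<close>, the choice
    \<open>t = - b / d\<close> lets the linear term outweigh the quadratic one.\<close>
  define d where "d = \<bar>c\<bar> + 1"
  have d: "0 < d" "c < d" unfolding d_def by auto
  have "0 \<le> 2 * (- b / d) * b + (- b / d)\<^sup>2 * c" by (rule assms)
  also have "\<dots> = (b\<^sup>2 / d) * (c / d - 2)" using d
    by (simp add: field_simps power2_eq_square)
  also have "\<dots> < 0"
  proof (rule mult_pos_neg)
    show "0 < b\<^sup>2 / d" using b d by simp
    have "c / d < 1" using d by simp
    then show "c / d - 2 < 0" by simp
  qed
  finally show False by simp
qed

lemma vec_inner_one: "(y :: real ^ 'n::finite) \<bullet> 1 = (\<Sum>i\<in>UNIV. y $ i)"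
  by (simp add: inner_vec_def)

section \<open>Neighbourhood matrix and Laplacian of a regular graph\<close>

locale connected_regular_graph =
  fixes E :: "('n::finite \<times> 'n) set" and V :: nat
  assumes card_ge_2: "CARD('n) \<ge> 2"
    and sym_E: "sym E"
    and connected: "(i, j) \<in> E\<^sup>*"
    and regular: "card (closed_nbhd E i) = V"
begin

abbreviation A where "A \<equiv> nbhd_matrix E"

lemma A_sym: "A $ i $ j = A $ j $ i"
  using sym_E by (auto simp: nbhd_matrix_def closed_nbhd_def sym_def)

lemma A_mult_vec: "(A *v y) $ i = (\<Sum>j\<in>closed_nbhd E i. y $ j)"
proof -
  have "(A *v y) $ i = (\<Sum>j\<in>UNIV. if j \<in> closed_nbhd E i then y $ j else 0)"
    unfolding matrix_vector_mult_def nbhd_matrix_def by (simp, intro sum.cong) auto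
  then show ?thesis by (simp add: sum.If_cases)
qed

lemma A_row_sum: "(\<Sum>j\<in>UNIV. A $ i $ j) = V"
  using A_mult_vec[of 1 i] regular by (simp add: matrix_vector_mult_def)

lemma A_mult_one: "A *v 1 = real V *\<^sub>R 1"
  by (simp add: vec_eq_iff A_mult_vec regular)

lemma V_pos: "V > 0"
proof -
  have "closed_nbhd E undefined \<noteq> {}" by (simp add: closed_nbhd_def)
  then show ?thesis using regular[of undefined] by (metis card_gt_0_iff finite)
qed

lemma A_self_adjoint: "x \<bullet> (A *v y) = (A *v x) \<bullet> y"
proof -
  have "transpose A = A" by (simp add: transpose_def vec_eq_iff A_sym)
  then show ?thesis using dot_lmul_matrix[of x A y] by (metis transpose_matrix_vector)
qed

text \<open>Since \<open>V\<close> counts the vertex itself, this is the usual graph Laplacian: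
  \<open>V - 1\<close> on the diagonal minus the adjacency of distinct vertices, the ones on the
  diagonal of \<open>A\<close> being cancelled.\<close>

definition L where "L y = real V *\<^sub>R y - A *v y"

lemma L_add: "L (x + y) = L x + L y"
  by (simp add: L_def algebra_simps matrix_vector_right_distrib)

lemma L_scaleR: "L (c *\<^sub>R x) = c *\<^sub>R L x"
  by (simp add: L_def algebra_simps matrix_vector_mult_scaleR)

lemma L_self_adjoint: "x \<bullet> L y = L x \<bullet> y"
  by (simp add: L_def inner_diff A_self_adjoint)

lemma L_one: "L 1 = 0"
  by (simp add: L_def A_mult_one)

text \<open>Expanding the square, symmetry and the constant row sums of \<open>A\<close> turn both
  pure squares into \<open>V * (y \<bullet> y)\<close>. Each pair of adjacent vertices occurs twice,
  hence the division by 2.\<close>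

lemma L_Dirichlet_form:
  "y \<bullet> L y = (\<Sum>i\<in>UNIV. \<Sum>j\<in>UNIV. A $ i $ j * (y $ i - y $ j)\<^sup>2) / 2"
proof -
  have 1: "(\<Sum>i\<in>UNIV. \<Sum>j\<in>UNIV. A $ i $ j * (y $ i)\<^sup>2) = V * (y \<bullet> y)"
    by (simp add: A_row_sum inner_vec_def sum_distrib_left power2_eq_square
        flip: sum_distrib_right)
  then have 2: "(\<Sum>i\<in>UNIV. \<Sum>j\<in>UNIV. A $ i $ j * (y $ j)\<^sup>2) = V * (y \<bullet> y)"
    by (subst sum.swap) (simp add: A_sym)
  have 3: "(\<Sum>i\<in>UNIV. \<Sum>j\<in>UNIV. A $ i $ j * (y $ i * y $ j)) = y \<bullet> (A *v y)"
    by (simp add: inner_vec_def matrix_vector_mult_def sum_distrib_left mult_ac)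
  have "(\<Sum>i\<in>UNIV. \<Sum>j\<in>UNIV. A $ i $ j * (y $ i - y $ j)\<^sup>2) =
    (\<Sum>i\<in>UNIV. \<Sum>j\<in>UNIV. A $ i $ j * (y $ i)\<^sup>2) + (\<Sum>i\<in>UNIV. \<Sum>j\<in>UNIV. A $ i $ j * (y $ j)\<^sup>2)
    - 2 * (\<Sum>i\<in>UNIV. \<Sum>j\<in>UNIV. A $ i $ j * (y $ i * y $ j))"
    by (simp add: power2_diff algebra_simps sum.distrib sum_subtractf sum_distrib_left)
  also have "\<dots> = 2 * (y \<bullet> L y)"
    unfolding 1 2 3 by (simp add: L_def inner_diff)
  finally show ?thesis by simp
qed

lemma L_nonneg: "0 \<le> y \<bullet> L y"
  unfolding L_Dirichlet_form by (auto intro!: sum_nonneg simp: nbhd_matrix_def)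

text \<open>A vanishing Dirichlet form makes \<open>y\<close> constant across every edge, and
  connectedness carries this along paths.\<close>

lemma L_kernel:
  assumes "y \<bullet> L y = 0"
  shows "y $ i = y $ j"
proof -
  have "(\<Sum>i\<in>UNIV. \<Sum>j\<in>UNIV. A $ i $ j * (y $ i - y $ j)\<^sup>2) = 0"
    using assms unfolding L_Dirichlet_form by simp
  then have z: "A $ i $ j * (y $ i - y $ j)\<^sup>2 = 0" for i j
    by (subst (asm) sum_nonneg_eq_0_iff; (subst (asm) sum_nonneg_eq_0_iff)?)
       (auto intro!: sum_nonneg simp: nbhd_matrix_def)
  have step: "y $ i = y $ j" if "(i, j) \<in> E" for i j
    using z[of i j] that by (simp add: nbhd_matrix_def closed_nbhd_def)
  have "(i, j) \<in> E\<^sup>*" by (rule connected)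
  then show ?thesis by (induction rule: rtrancl_induct) (auto dest: step)
qed

text \<open>Minimising the Dirichlet form over the compact unit sphere orthogonal to
  \<open>1\<close> avoids diagonalising \<open>A\<close>. The minimiser is an eigenvector by the
  first-order condition, and the minimum is positive because the kernel of the form consists of
  constant vectors.\<close>

lemma Rayleigh_minimum:
  obtains \<mu> y0 where "\<mu> > 0" "y0 \<noteq> 0" "L y0 = \<mu> *\<^sub>R y0"
    "\<And>y. y \<bullet> 1 = 0 \<Longrightarrow> \<mu> * (y \<bullet> y) \<le> y \<bullet> L y"
proof -
  define S where "S = {y :: real ^ 'n. norm y = 1 \<and> y \<bullet> 1 = 0}"
  have S_eq: "S = sphere 0 1 \<inter> {y. 1 \<bullet> y = 0}"
    by (auto simp: S_def inner_commute)
  have "compact S"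
    unfolding S_eq by (intro compact_Int_closed compact_sphere closed_hyperplane)
  moreover have "S \<noteq> {}"
  proof -
    obtain i j :: 'n where ij: "i \<noteq> j"
      using card_ge_2 by (metis One_nat_def card_1_singleton_iff card_le_Suc0_iff_eq
          finite not_less_eq_eq numeral_2_eq_2 UNIV_I)
    define w :: "real ^ 'n" where "w = axis i 1 - axis j 1"
    have "w $ i \<noteq> 0" using ij by (simp add: w_def axis_def)
    then have "w \<noteq> 0" by auto
    moreover have "w \<bullet> 1 = 0" by (simp add: w_def inner_diff inner_axis' )
    ultimately have "w /\<^sub>R norm w \<in> S" by (simp add: S_def)
    then show ?thesis by auto
  qed
  moreover have "continuous_on S (\<lambda>y. y \<bullet> L y)"
    unfolding L_def by (intro continuous_intros)
  ultimately obtain y0 where y0: "y0 \<in> S" and min: "\<And>y. y \<in> S \<Longrightarrow> y0 \<bullet> L y0 \<le> y \<bullet> L y"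
    using continuous_attains_inf[of S "\<lambda>y. y \<bullet> L y"] by auto
  define \<mu> where "\<mu> = y0 \<bullet> L y0"
  have n0: "norm y0 = 1" "y0 \<bullet> 1 = 0" using y0 by (auto simp: S_def)
  have y00: "y0 \<noteq> 0" using n0 by auto
  have bound: "\<mu> * (y \<bullet> y) \<le> y \<bullet> L y" if "y \<bullet> 1 = 0" for y
  proof (cases "y = 0")
    case False
    then have "y /\<^sub>R norm y \<in> S" using that by (simp add: S_def)
    then have "\<mu> \<le> (y /\<^sub>R norm y) \<bullet> L (y /\<^sub>R norm y)" unfolding \<mu>_def by (rule min)
    also have "\<dots> = (y \<bullet> L y) / (y \<bullet> y)"
      by (simp add: L_scaleR dot_square_norm power2_eq_square divide_simps)
    finally show ?thesis using False by (simp add: field_simps)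
  qed (simp add: L_def)
  have "\<mu> > 0"
  proof (rule ccontr)
    assume "\<not> \<mu> > 0"
    then have "y0 \<bullet> L y0 = 0" using L_nonneg[of y0] by (simp add: \<mu>_def)
    then have c: "y0 $ i = y0 $ undefined" for i by (rule L_kernel)
    then have "(\<Sum>i\<in>UNIV. y0 $ i) = real CARD('n) * y0 $ undefined"
      by (metis sum_constant sum.cong)
    with n0(2) have "y0 $ undefined = 0" by (simp add: vec_inner_one)
    with c have "y0 = 0" by (simp add: vec_eq_iff)
    with y00 show False by simp
  qed
  moreover have "L y0 = \<mu> *\<^sub>R y0"
  proof -
    \<comment> \<open>The residual of the eigenvalue equation is itself orthogonal to
      \<open>1\<close>, hence an admissible direction of variation; the linear coefficient along it
      is \<open>w \<bullet> w\<close>.\<close>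
    define w where "w = L y0 - \<mu> *\<^sub>R y0"
    have w1: "w \<bullet> 1 = 0"
      using L_self_adjoint[of 1 y0] n0 by (simp add: w_def inner_diff L_one inner_commute)
    have "w \<bullet> w = 0"
    proof (rule nonneg_quadratic_imp_linear_zero)
      fix t :: real
      have "(y0 + t *\<^sub>R w) \<bullet> 1 = 0" using w1 n0 by (simp add: inner_add)
      from bound[OF this]
      have "0 \<le> (y0 + t *\<^sub>R w) \<bullet> L (y0 + t *\<^sub>R w) - \<mu> * ((y0 + t *\<^sub>R w) \<bullet> (y0 + t *\<^sub>R w))"
        by simp
      also have "\<dots> = 2 * t * (w \<bullet> L y0 - \<mu> * (w \<bullet> y0)) + t\<^sup>2 * (w \<bullet> L w - \<mu> * (w \<bullet> w))
        + (y0 \<bullet> L y0 - \<mu> * (y0 \<bullet> y0))"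
        using L_self_adjoint[of y0 w]
        by (simp add: L_add L_scaleR inner_add inner_commute algebra_simps power2_eq_square)
      also have "w \<bullet> L y0 - \<mu> * (w \<bullet> y0) = w \<bullet> w"
        by (simp add: w_def inner_diff)
      also have "y0 \<bullet> L y0 - \<mu> * (y0 \<bullet> y0) = 0"
        using n0 by (simp add: \<mu>_def dot_square_norm)
      finally show "0 \<le> 2 * t * (w \<bullet> w) + t\<^sup>2 * (w \<bullet> L w - \<mu> * (w \<bullet> w))" by simp
    qed
    then show ?thesis by (simp add: w_def)
  qed
  ultimately show ?thesis using that y00 bound by blast
qed

text \<open>The top eigenvalue is \<open>V\<close>, with eigenvector \<open>1\<close>, and
  \<open>V - \<mu>\<close> is another entry of the list, so the gap is at most the Rayleigh minimum
  \<open>\<mu>\<close>; Cauchy-Schwarz then converts the bound on the form into a bound on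
  \<open>L y\<close>. Nonnegativity is recorded so that the estimate may be squared later.\<close>

lemma spectral_gap_bound:
  shows "0 \<le> spectral_gap A" and "y \<bullet> 1 = 0 \<Longrightarrow> spectral_gap A * norm y \<le> norm (L y)"
proof -
  let ?K = "CARD('n)" and ?es = "eigenvalue_list A"
  obtain \<mu> y0 where \<mu>: "\<mu> > 0" "y0 \<noteq> 0" "L y0 = \<mu> *\<^sub>R y0"
    and bound: "\<And>y. y \<bullet> 1 = 0 \<Longrightarrow> \<mu> * (y \<bullet> y) \<le> y \<bullet> L y"
    by (rule Rayleigh_minimum) (rule that)
  have len: "length ?es = ?K" by (rule length_eigenvalue_list) (rule A_sym)
  have srt: "sorted ?es" by (simp add: eigenvalue_list_def)
  have le_V: "x \<le> V" if x: "x \<in> set ?es" for x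
  proof -
    obtain v where v: "v \<noteq> 0" "A *v v = x *\<^sub>R v" using x set_eigenvalue_list[of x A] by auto
    have "0 \<le> v \<bullet> L v" by (rule L_nonneg)
    also have "\<dots> = (V - x) * (v \<bullet> v)" by (simp add: L_def v inner_diff left_diff_distrib)
    finally have "0 \<le> (V - x) * (v \<bullet> v)" .
    moreover have "v \<bullet> v > 0" using v(1) by simp
    ultimately have "0 \<le> V - x" using zero_le_mult_iff[of "V - x" "v \<bullet> v"] by linarith
    then show ?thesis by simp
  qed
  have "(1 :: real ^ 'n) \<noteq> 0" by (simp add: vec_eq_iff)
  with A_mult_one have V_in: "real V \<in> set ?es" unfolding set_eigenvalue_list by blast
  have "A *v y0 = (V - \<mu>) *\<^sub>R y0"
    using \<mu>(3) by (simp add: L_def algebra_simps)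
  with \<mu>(2) have "V - \<mu> \<in> set ?es" unfolding set_eigenvalue_list by blast
  then obtain m where m: "m < ?K" "?es ! m = V - \<mu>" by (metis in_set_conv_nth len)
  obtain k where k: "k < ?K" "?es ! k = V" using V_in by (metis in_set_conv_nth len)
  have "?es ! k \<le> ?es ! (?K - 1)" using srt k len by (intro sorted_nth_mono) auto
  moreover have "?es ! (?K - 1) \<le> V" using len by (intro le_V nth_mem) auto
  ultimately have last: "?es ! (?K - 1) = V" using k by simp
  \<comment> \<open>The entry at \<open>m\<close> lies strictly below \<open>V\<close>, the last
    entry, so \<open>m\<close> is at most \<open>?K - 2\<close>, the index that defines the
    gap.\<close>
  have "m \<noteq> ?K - 1" using m last \<mu>(1) by auto
  then have "?es ! m \<le> ?es ! (?K - 2)" using srt m len by (intro sorted_nth_mono) auto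
  then have gap_le: "spectral_gap A \<le> \<mu>" using last m(2) by (simp add: spectral_gap_def)
  have "?es ! (?K - 2) \<le> ?es ! (?K - 1)" using srt len by (intro sorted_nth_mono) auto
  then show "0 \<le> spectral_gap A" by (simp add: spectral_gap_def)
  show "spectral_gap A * norm y \<le> norm (L y)" if y: "y \<bullet> 1 = 0"
  proof (cases "y = 0")
    case False
    have "\<mu> * norm y * norm y \<le> y \<bullet> L y"
      using bound[OF y] by (simp add: dot_square_norm power2_eq_square mult_ac)
    also have "\<dots> \<le> norm (L y) * norm y"
      using norm_cauchy_schwarz[of y "L y"] by (simp add: mult.commute)
    finally have "\<mu> * norm y \<le> norm (L y)" using False by simp
    moreover have "spectral_gap A * norm y \<le> \<mu> * norm y" using gap_le by (rule mult_right_mono) simp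
    ultimately show ?thesis by simp
  qed simp
qed

end


section \<open>Local existence and maximal solutions\<close>

text \<open>Banach's fixed point theorem for the Picard operator; \<open>L * e < 1\<close> makes it
  a contraction in the plain supremum norm.\<close>

lemma lipschitz_ode_solution_global:
  fixes g :: "'a::banach \<Rightarrow> 'a"
  assumes lip: "L-lipschitz_on UNIV g" and bound: "\<And>x. norm (g x) \<le> B"
    and e: "0 < e" "L * e < 1"
  obtains w where "w 0 = x0" "continuous_on {0..e} w"
    "\<And>t. t \<in> {0..e} \<Longrightarrow> (w has_vector_derivative g (w t)) (at t within {0..e})"
proof -
  have L0: "0 \<le> L" using lip by (rule lipschitz_on_nonneg)
  have B0: "0 \<le> B" using bound[of 0] norm_ge_zero order_trans by blast
  have cont_g: "continuous_on UNIV g" using lip by (rule lipschitz_on_continuous_on)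
  \<comment> \<open>Clamping time to \<open>{0..e}\<close> makes the Picard iterates bounded and
    continuous on the whole line, so they live in the complete type of bounded continuous
    functions.\<close>
  define cl where "cl t = max 0 (min e t)" for t :: real
  have cl: "cl t \<in> {0..e}" for t using e by (auto simp: cl_def)
  have cl_id: "cl t = t" if "t \<in> {0..e}" for t using that by (auto simp: cl_def)
  have cont_cl: "continuous_on UNIV cl" unfolding cl_def by (intro continuous_intros)
  define P where "P w t = x0 + integral {0..cl t} (\<lambda>s. g (apply_bcontfun w s))"
    for w :: "real \<Rightarrow>\<^sub>C 'a" and t
  have cont_gw: "continuous_on S (\<lambda>s. g (apply_bcontfun w s))" for w :: "real \<Rightarrow>\<^sub>C 'a" and S
    by (rule continuous_on_compose2[OF cont_g]) auto
  have int_gw: "(\<lambda>s. g (apply_bcontfun w s)) integrable_on {a..b}" for w :: "real \<Rightarrow>\<^sub>C 'a" and a b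
    by (rule integrable_continuous_real) (rule cont_gw)
  have cont_P: "continuous_on UNIV (P w)" for w
  proof -
    have "continuous_on {0..e} (\<lambda>t. integral {0..t} (\<lambda>s. g (apply_bcontfun w s)))"
      by (rule indefinite_integral_continuous_1) (rule int_gw)
    then have "continuous_on UNIV (\<lambda>t. integral {0..cl t} (\<lambda>s. g (apply_bcontfun w s)))"
      by (rule continuous_on_compose2[OF _ cont_cl]) (use cl in auto)
    then show ?thesis unfolding P_def by (intro continuous_intros)
  qed
  have bound_P: "norm (P w t) \<le> norm x0 + B * e" for w t
  proof -
    have "norm (integral {0..cl t} (\<lambda>s. g (apply_bcontfun w s))) \<le> B * (cl t - 0)"
      using cl[of t] by (intro integral_bound cont_gw) (auto simp: bound)
    also have "\<dots> \<le> B * e" using cl[of t] B0 by (intro mult_left_mono) auto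
    finally show ?thesis unfolding P_def by (intro norm_triangle_le) auto
  qed
  have P_bcont: "P w \<in> bcontfun" for w
    using cont_P bound_P by (rule bcontfun_normI)
  define T where "T w = Bcontfun (P w)" for w
  have T: "apply_bcontfun (T w) = P w" for w
    unfolding T_def using P_bcont by (rule Bcontfun_inverse)
  have "dist (T v) (T w) \<le> (L * e) * dist v w" for v w
  proof (rule dist_bound)
    fix t
    have "dist (P v t) (P w t) =
      norm (integral {0..cl t} (\<lambda>s. g (apply_bcontfun v s) - g (apply_bcontfun w s)))"
      unfolding P_def dist_norm by (subst integral_diff[OF int_gw int_gw]) simp
    also have "\<dots> \<le> (L * dist v w) * (cl t - 0)"
    proof (rule integral_bound)
      fix s
      have "norm (g (apply_bcontfun v s) - g (apply_bcontfun w s)) \<le>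
        L * dist (apply_bcontfun v s) (apply_bcontfun w s)"
        using lipschitz_onD[OF lip, of "apply_bcontfun v s" "apply_bcontfun w s"]
        by (simp add: dist_norm)
      also have "\<dots> \<le> L * dist v w" by (intro mult_left_mono dist_bounded L0)
      finally show "norm (g (apply_bcontfun v s) - g (apply_bcontfun w s)) \<le> L * dist v w" .
    next
      show "continuous_on {0..cl t} (\<lambda>s. g (apply_bcontfun v s) - g (apply_bcontfun w s))"
        by (intro continuous_on_diff cont_gw)
    qed (use cl[of t] in auto)
    also have "\<dots> \<le> (L * dist v w) * e"
      using cl[of t] L0 by (intro mult_left_mono) auto
    finally show "dist (apply_bcontfun (T v) t) (apply_bcontfun (T w) t) \<le> (L * e) * dist v w"
      by (simp add: T mult_ac)
  qed
  then obtain w where w: "T w = w"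
    using banach_fix_type[of "L * e" T] L0 e by auto
  then have w_eq: "apply_bcontfun w t = P w t" for t by (metis T)
  show ?thesis
  proof
    show "apply_bcontfun w 0 = x0" using e unfolding w_eq by (simp add: P_def cl_def)
    show "continuous_on {0..e} (apply_bcontfun w)" by auto
    fix t assume t: "t \<in> {0..e}"
    have "((\<lambda>t. x0 + integral {0..t} (\<lambda>s. g (apply_bcontfun w s)))
      has_vector_derivative 0 + g (apply_bcontfun w t)) (at t within {0..e})"
      by (intro has_vector_derivative_add has_vector_derivative_const
          integral_has_vector_derivative cont_gw t)
    then show "(apply_bcontfun w has_vector_derivative g (apply_bcontfun w t)) (at t within {0..e})"
      unfolding add_0
    proof (rule has_vector_derivative_transform[OF t, rotated])
      fix s assume "s \<in> {0..e}"
      then show "apply_bcontfun w s = x0 + integral {0..s} (\<lambda>s. g (apply_bcontfun w s))"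
        using w_eq[of s] by (simp only: P_def cl_id)
    qed
  qed
qed

lemma vector_derivative_bound:
  fixes w :: "real \<Rightarrow> 'a::real_normed_vector"
  assumes deriv: "\<And>t. t \<in> S \<Longrightarrow> (w has_vector_derivative w' t) (at t within S)"
    and "\<And>t. t \<in> S \<Longrightarrow> norm (w' t) \<le> B" and "convex S" "x \<in> S" "y \<in> S"
  shows "norm (w x - w y) \<le> B * norm (x - y)"
proof (rule differentiable_bound[where S = S])
  show "(w has_derivative (\<lambda>h. h *\<^sub>R w' t)) (at t within S)" if "t \<in> S" for t
    using deriv[OF that] by (simp add: has_vector_derivative_def)
  show "onorm (\<lambda>h. h *\<^sub>R w' t) \<le> B" if "t \<in> S" for t
    using assms(2)[OF that] by (intro onorm_le) (auto simp: mult.commute[of B] intro: mult_left_mono)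
qed (use assms in auto)

text \<open>Composing \<open>f\<close> with the 1-Lipschitz projection onto the ball gives a
  globally Lipschitz bounded field. Its solution cannot leave the ball within time \<open>e\<close>,
  and there the two fields agree.\<close>

lemma local_solution_exists:
  fixes f :: "'a::euclidean_space \<Rightarrow> 'a"
  assumes r: "0 < r" "cball x0 r \<subseteq> S" and lip: "L-lipschitz_on (cball x0 r) f"
  obtains e w where "0 < e" "w 0 = x0" "solution_on f S {0..e} w"
proof -
  define g where "g x = f (closest_point (cball x0 r) x)" for x
  have ne: "cball x0 r \<noteq> {}" using r by auto
  have cp: "closest_point (cball x0 r) x \<in> cball x0 r" for x
    using ne by (intro closest_point_in_set) auto
  have L0: "0 \<le> L" using lip by (rule lipschitz_on_nonneg)
  have lip_g: "L-lipschitz_on UNIV g"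
  proof (rule lipschitz_onI)
    fix x y
    have "dist (g x) (g y) \<le> L * dist (closest_point (cball x0 r) x) (closest_point (cball x0 r) y)"
      unfolding g_def by (rule lipschitz_onD[OF lip]) (rule cp)+
    also have "\<dots> \<le> L * dist x y"
      using ne by (intro mult_left_mono closest_point_lipschitz L0) auto
    finally show "dist (g x) (g y) \<le> L * dist x y" .
  qed (rule L0)
  have "compact (f ` cball x0 r)"
    using lip by (intro compact_continuous_image lipschitz_on_continuous_on) auto
  then obtain B where B: "B > 0" "\<And>y. y \<in> f ` cball x0 r \<Longrightarrow> norm y \<le> B"
    using compact_imp_bounded bounded_pos by metis
  then have bound_g: "norm (g x) \<le> B" for x unfolding g_def using cp by blast
  \<comment> \<open>The first bound yields \<open>L * e < 1\<close>, with \<open>L + 1\<close>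
    guarding against division by 0; the second limits the distance travelled at speed
    \<open>B\<close> to \<open>r\<close>.\<close>
  define e where "e = min (1 / (2 * (L + 1))) (r / B)"
  have e: "0 < e" using L0 r B by (simp add: e_def)
  have "L * e \<le> L * (1 / (2 * (L + 1)))" using L0 by (intro mult_left_mono) (auto simp: e_def)
  also have "\<dots> < 1" using L0 by (simp add: divide_simps)
  finally have Le: "L * e < 1" .
  have Be: "B * e \<le> r"
  proof -
    have "B * e \<le> B * (r / B)" using B by (intro mult_left_mono) (auto simp: e_def)
    then show ?thesis using B by simp
  qed
  from lip_g bound_g e Le obtain w where w0: "w 0 = x0" and cw: "continuous_on {0..e} w"
    and dw: "\<And>t. t \<in> {0..e} \<Longrightarrow> (w has_vector_derivative g (w t)) (at t within {0..e})"
    by (rule lipschitz_ode_solution_global[where ?x0.0 = x0]) (rule that)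
  have in_ball: "w t \<in> cball x0 r" if t: "t \<in> {0..e}" for t
  proof -
    have "norm (w t - w 0) \<le> B * norm (t - 0)"
    proof (rule vector_derivative_bound)
      show "(w has_vector_derivative g (w s)) (at s within {0..e})" if "s \<in> {0..e}" for s
        using that by (rule dw)
    qed (use t bound_g in auto)
    also have "\<dots> \<le> B * e" using t B by (intro mult_left_mono) auto
    finally show ?thesis using Be by (simp add: w0 dist_norm norm_minus_commute)
  qed
  have "solution_on f S {0..e} w"
    unfolding solution_on_def
  proof (intro conjI ballI)
    fix t assume t: "t \<in> {0..e}"
    show "w t \<in> S" using in_ball[OF t] r by auto
    have "g (w t) = f (w t)" unfolding g_def using closest_point_self[OF in_ball[OF t]] by simp
    with dw[OF t] show "(w has_vector_derivative f (w t)) (at t within {0..e})" by simp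
  qed (use e in \<open>auto simp: is_interval_cc\<close>)
  with that e w0 show ?thesis by blast
qed


text \<open>Autonomy allows \<open>w\<close> to be shifted by \<open>c\<close>. At the junction both
  one-sided derivatives equal \<open>f (z c)\<close>.\<close>

lemma solution_on_extend:
  fixes f :: "'a::real_normed_vector \<Rightarrow> 'a"
  assumes z: "solution_on f S {0..c} z" and w: "solution_on f S {0..e} w"
    and c: "0 \<le> c" and e: "0 < e" and w0: "w 0 = z c"
  shows "solution_on f S {0..c + e} (\<lambda>t. if t \<in> {0..c} then z t else w (t - c))"
  unfolding solution_on_def
proof (intro conjI ballI)
  fix t assume t: "t \<in> {0..c + e}"
  show "(if t \<in> {0..c} then z t else w (t - c)) \<in> S"
    using z w t e by (auto simp: solution_on_def)
  have dw: "((\<lambda>t. w (t - c)) has_vector_derivative f (w (t - c))) (at t within {c..c + e})"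
    if "t \<in> {c..c + e}" for t
  proof -
    have img: "(\<lambda>t. t - c) ` {c..c + e} = {0..e}"
      by (auto simp: image_iff intro!: bexI[of _ "_ + c"])
    have "((\<lambda>t. t - c) has_vector_derivative 1) (at t within {c..c + e})"
      by (auto intro!: derivative_eq_intros)
    moreover have "(w has_vector_derivative f (w (t - c))) (at (t - c) within (\<lambda>t. t - c) ` {c..c + e})"
      using w that unfolding img by (auto simp: solution_on_def)
    ultimately show ?thesis
      using vector_diff_chain_within[of "\<lambda>t. t - c" 1 t "{c..c + e}" w] by (simp add: o_def)
  qed
  have dz: "(z has_vector_derivative f (z t)) (at t within {0..c})" if "t \<in> {0..c}" for t
    using z that by (auto simp: solution_on_def)
  \<comment> \<open>The gluing rule asks for derivatives within each piece enlarged by the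
    intersection of the closures, which is just the point \<open>c\<close>.\<close>
  have cl: "closure {0..c} = {0..c}" "closure {c<..c + e} = {c..c + e}"
    using e by auto
  have un: "{0..c} \<union> ({0..c} \<inter> {c..c + e}) = {0..c}" "{c<..c + e} \<union> ({0..c} \<inter> {c..c + e}) = {c..c + e}"
    using c e by auto
  have "((\<lambda>t. if t \<in> {0..c} then z t else w (t - c)) has_vector_derivative
    (if t \<in> {0..c} then f (z t) else f (w (t - c)))) (at t within {0..c + e})"
    by (rule has_vector_derivative_If_within_closures[where T = "{c<..c + e}"], unfold cl un)
       (use t c e w0 in \<open>auto intro!: dz dw\<close>)
  then show "((\<lambda>t. if t \<in> {0..c} then z t else w (t - c)) has_vector_derivative
    f (if t \<in> {0..c} then z t else w (t - c))) (at t within {0..c + e})"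
    by (simp add: if_distrib)
qed (use c e in \<open>auto simp: is_interval_cc\<close>)

text \<open>The integral equation holds up to and including \<open>c\<close> by continuity, and
  differentiating it gives the one-sided derivative at \<open>c\<close>.\<close>

lemma solution_on_closed_endpoint:
  fixes f :: "'a::banach \<Rightarrow> 'a"
  assumes z: "solution_on f S {0..<c} z" and c: "0 < c" and f: "continuous_on S f"
    and g: "continuous_on {0..c} g" "\<And>t. t \<in> {0..<c} \<Longrightarrow> g t = z t" "g c \<in> S"
  shows "solution_on f S {0..c} g"
  unfolding solution_on_def
proof (intro conjI ballI)
  have gS: "g t \<in> S" if "t \<in> {0..c}" for t
    using that z g by (cases "t = c") (auto simp: solution_on_def)
  have cont: "continuous_on {0..c} (\<lambda>s. f (g s))"
    by (rule continuous_on_compose2[OF f g(1)]) (use gS in auto)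
  have deriv: "(g has_vector_derivative f (g s)) (at s)" if s: "s \<in> {0<..<c}" for s
  proof -
    have "s \<in> interior {0..<c}" using s by simp
    then have "(z has_vector_derivative f (z s)) (at s)"
      using z s at_within_interior[of s "{0..<c}"] unfolding solution_on_def
      by (metis atLeastLessThan_iff greaterThanLessThan_iff less_imp_le)
    then have "(g has_vector_derivative f (z s)) (at s)"
      by (rule has_vector_derivative_transform_within_open[where S = "{0<..<c}"]) (use s g in auto)
    then show ?thesis using g(2)[of s] s by simp
  qed
  have eq: "g t = g 0 + integral {0..t} (\<lambda>s. f (g s))" if t: "t \<in> {0..c}" for t
  proof -
    have "((\<lambda>s. f (g s)) has_integral (g t - g 0)) {0..t}"
      by (rule fundamental_theorem_of_calculus_interior)
         (use t deriv g(1) in \<open>auto elim: continuous_on_subset\<close>)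
    then show ?thesis by (simp add: integral_unique)
  qed
  fix t assume t: "t \<in> {0..c}"
  show "g t \<in> S" using t by (rule gS)
  have "((\<lambda>t. g 0 + integral {0..t} (\<lambda>s. f (g s))) has_vector_derivative 0 + f (g t))
    (at t within {0..c})"
    by (intro has_vector_derivative_add has_vector_derivative_const
        integral_has_vector_derivative cont t)
  then show "(g has_vector_derivative f (g t)) (at t within {0..c})"
    unfolding add_0 by (rule has_vector_derivative_transform[OF t eq, rotated])
qed (use c in \<open>auto simp: is_interval_cc\<close>)

text \<open>Let the interval end at a finite \<open>c\<close>. If \<open>c\<close> belongs to it,
  local existence restarts the solution there. If not, bounded speed forces a limit at
  \<open>c\<close>, and a limit in \<open>S\<close> would allow adding the endpoint. Both
  prolongations contradict maximality.\<close>

lemma maximal_solution_dichotomy: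
  fixes f :: "'a::euclidean_space \<Rightarrow> 'a"
  assumes lip: "\<And>x. x \<in> S \<Longrightarrow> \<exists>r>0. \<exists>L. cball x r \<subseteq> S \<and> L-lipschitz_on (cball x r) f"
    and bound: "\<And>x. x \<in> S \<Longrightarrow> norm (f x) \<le> B"
    and max: "maximal_solution_on f S I z"
  shows "I = {0..} \<or> (\<exists>c>0. \<exists>zc. I = {0..<c} \<and> (z \<longlongrightarrow> zc) (at_left c) \<and> zc \<notin> S)"
proof (rule ccontr)
  assume contra: "\<not> ?thesis"
  have sol: "solution_on f S I z"
    and maxD: "\<And>J w. solution_on f S J w \<Longrightarrow> I \<subseteq> J \<Longrightarrow> (\<And>t. t \<in> I \<Longrightarrow> w t = z t) \<Longrightarrow> J = I"
    using max unfolding maximal_solution_on_def by blast+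
  have int: "is_interval I" and I0: "0 \<in> I" and Ipos: "I \<subseteq> {0..}"
    and zS: "\<And>t. t \<in> I \<Longrightarrow> z t \<in> S"
    and dz: "\<And>t. t \<in> I \<Longrightarrow> (z has_vector_derivative f (z t)) (at t within I)"
    using sol unfolding solution_on_def by blast+
  have mem: "t \<in> I" if "0 \<le> t" "t \<le> s" "s \<in> I" for s t
    using int I0 that unfolding is_interval_1 by blast
  have "bdd_above I"
  proof (rule ccontr)
    assume "\<not> bdd_above I"
    then have "\<exists>s\<in>I. t \<le> s" for t unfolding bdd_above_def by (meson linear)
    then have "I = {0..}" using mem Ipos by fastforce
    with contra show False by simp
  qed
  define c where "c = Sup I"
  have I_le: "I \<subseteq> {0..c}" using Ipos cSup_upper[OF _ \<open>bdd_above I\<close>] by (auto simp: c_def)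
  have I_ge: "{0..<c} \<subseteq> I"
  proof
    fix t assume t: "t \<in> {0..<c}"
    then obtain s where "s \<in> I" "t < s"
      using less_cSup_iff[OF _ \<open>bdd_above I\<close>, of t] I0 unfolding c_def by auto
    then show "t \<in> I" using mem[of t s] t by auto
  qed
  have c0: "0 \<le> c" using I0 I_le by auto
  show False
  proof (cases "c \<in> I")
    case True
    then have I_eq: "I = {0..c}" using I_le I_ge by (auto simp: order_le_less)
    obtain r L where "0 < r" "cball (z c) r \<subseteq> S" "L-lipschitz_on (cball (z c) r) f"
      using lip[OF zS[OF True]] by blast
    then obtain e w where ew: "0 < e" "w 0 = z c" "solution_on f S {0..e} w"
      by (rule local_solution_exists)
    have "{0..c + e} = I"
    proof (rule maxD)
      show "solution_on f S {0..c + e} (\<lambda>t. if t \<in> {0..c} then z t else w (t - c))"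
        using sol ew c0 unfolding I_eq by (intro solution_on_extend)
    qed (use I_eq ew in auto)
    then have "c + e \<in> {0..c}" using I_eq ew c0 by auto
    then show False using ew by simp
  next
    case False
    then have I_eq: "I = {0..<c}" using I_le I_ge by (auto simp: order_le_less)
    have c: "0 < c" using I0 I_eq by simp
    have "\<bar>B\<bar>-lipschitz_on I z"
    proof (rule lipschitz_onI)
      fix x y assume xy: "x \<in> I" "y \<in> I"
      have "norm (z x - z y) \<le> \<bar>B\<bar> * norm (x - y)"
      proof (rule vector_derivative_bound[OF dz])
        show "norm (f (z t)) \<le> \<bar>B\<bar>" if "t \<in> I" for t using bound[OF zS[OF that]] by simp
      qed (use xy int is_interval_convex in auto)
      then show "dist (z x) (z y) \<le> \<bar>B\<bar> * dist x y" by (simp add: dist_norm)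
    qed simp
    \<comment> \<open>A Lipschitz function extends to the closure \<open>{0..c}\<close>; the value
      \<open>g c\<close> is the limit of \<open>z\<close> at \<open>c\<close>.\<close>
    then obtain g where g: "\<bar>B\<bar>-lipschitz_on (closure I) g" "\<And>t. t \<in> I \<Longrightarrow> g t = z t"
      using lipschitz_extend_closure by blast
    have "closure I = {0..c}" using I_eq c by simp
    with g(1) have cont_g: "continuous_on {0..c} g" by (simp add: lipschitz_on_continuous_on)
    have "(g \<longlongrightarrow> g c) (at_left c)"
      using cont_g c by (simp add: continuous_on_Icc_at_leftD)
    then have "(z \<longlongrightarrow> g c) (at_left c)"
    proof (rule Lim_transform_eventually)
      have "eventually (\<lambda>t. t \<in> {0<..<c}) (at_left c)"
        using c by (intro eventually_at_left_real)
      then show "\<forall>\<^sub>F t in at_left c. g t = z t"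
        by eventually_elim (use g(2) I_eq in auto)
    qed
    with contra I_eq c have gc: "g c \<in> S" by blast
    have f: "continuous_on S f"
    proof (rule continuous_at_imp_continuous_on, rule ballI)
      fix x assume "x \<in> S"
      from lip[OF this] obtain r L where r: "0 < r" "L-lipschitz_on (cball x r) f" by blast
      then have "continuous_on (cball x r) f" by (intro lipschitz_on_continuous_on)
      then show "isCont f x"
        by (rule continuous_on_interior) (use r in \<open>simp add: interior_cball\<close>)
    qed
    have "{0..c} = I"
    proof (rule maxD)
      show "solution_on f S {0..c} g"
        by (rule solution_on_closed_endpoint) (use sol I_eq c f cont_g g gc in auto)
    qed (use I_eq g in auto)
    then show False using False c by auto
  qed
qed


section \<open>Homogeneous vector fields contracting towards the diagonal\<close>

text \<open>A barrier argument for a monotonicity that is only known below the level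
  \<open>M\<close>: up to the first time an intermediate level is hit, \<open>W\<close> cannot have
  increased, so that level is never reached.\<close>

lemma sublevel_trap:
  fixes W :: "real \<Rightarrow> real"
  assumes T: "0 \<le> T" and cont: "continuous_on {0..T} W" and init: "W 0 < M"
    and deriv: "\<And>t. 0 < t \<Longrightarrow> t < T \<Longrightarrow> W t < M \<Longrightarrow> \<exists>d. (W has_real_derivative d) (at t) \<and> d \<le> 0"
  shows "W T \<le> W 0"
proof (rule ccontr)
  assume "\<not> W T \<le> W 0"
  \<comment> \<open>Taking \<open>m\<close> strictly below \<open>M\<close> keeps the derivative
    hypothesis available until \<open>m\<close> is hit, and \<open>m < W T\<close> lets the
    intermediate value theorem produce such a time.\<close>
  then obtain m where m: "W 0 < m" "m < M" "m < W T"
    using init dense[of "W 0" "min M (W T)"] by auto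
  define Z where "Z = {t \<in> {0..T}. W t = m}"
  have "closed Z"
    unfolding Z_def by (rule continuous_closed_preimage_constant[OF cont]) simp
  moreover have "bounded Z"
    by (rule bounded_subset[of "{0..T}"]) (auto simp: Z_def)
  ultimately have "compact Z" by (simp add: compact_eq_bounded_closed)
  moreover have "Z \<noteq> {}"
    using IVT'[of W 0 m T] m T cont by (auto simp: Z_def)
  ultimately obtain t1 where t1: "t1 \<in> Z" and least: "\<And>t. t \<in> Z \<Longrightarrow> t1 \<le> t"
    using compact_attains_inf[of Z] by auto
  have t1T: "0 \<le> t1" "t1 \<le> T" "W t1 = m" using t1 by (auto simp: Z_def)
  have below: "W t < m" if t: "0 \<le> t" "t < t1" for t
  proof (rule ccontr)
    assume "\<not> W t < m"
    then obtain s where "0 \<le> s" "s \<le> t" "W s = m"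
      using IVT'[of W 0 m t] m t t1T continuous_on_subset[OF cont, of "{0..t}"] by auto
    then have "s \<in> Z" using t t1T by (auto simp: Z_def)
    with least[of s] t \<open>s \<le> t\<close> show False by simp
  qed
  have "W t1 \<le> W 0"
  proof (rule DERIV_nonpos_imp_decreasing_open[of 0 t1 W])
    show "continuous_on {0..t1} W" using cont t1T by (auto elim: continuous_on_subset)
  next
    fix t assume "0 < t" "t < t1"
    then show "\<exists>d. (W has_real_derivative d) (at t) \<and> d \<le> 0"
      using deriv[of t] below[of t] t1T m by simp
  qed (rule t1T)
  with m t1T show False by simp
qed

text \<open>Isolates what the dynamics need from the graph. In \<open>contracting\<close> the term
  with \<open>\<beta>\<close> is subtracted because deviations are measured relative to the mean,
  which itself moves at a rate close to \<open>\<beta>\<close>.\<close>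

locale homogeneous_field =
  fixes G :: "real ^ 'n::finite \<Rightarrow> real ^ 'n" and D :: "real ^ 'n \<Rightarrow> real ^ 'n"
    and \<beta> \<delta> B :: real
  assumes homogeneous: "x \<in> pos_orthant \<Longrightarrow> 0 < c \<Longrightarrow> G (c *\<^sub>R x) = G x"
    and lipschitz: "x \<in> pos_orthant \<Longrightarrow>
      \<exists>r>0. \<exists>L. cball x r \<subseteq> pos_orthant \<and> L-lipschitz_on (cball x r) G"
    and bounded: "x \<in> pos_orthant \<Longrightarrow> norm (G x) \<le> B"
    and G_one: "G 1 = \<beta> *\<^sub>R 1"
    and deriv_one: "(G has_derivative D) (at 1)"
    and delta_pos: "0 < \<delta>"
    and contracting: "y \<bullet> 1 = 0 \<Longrightarrow> y \<bullet> D y - \<beta> * (y \<bullet> y) \<le> - \<delta> * (y \<bullet> y)"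
begin

definition mean :: "real ^ 'n \<Rightarrow> real" where "mean x = x \<bullet> 1 / real CARD('n)"

lemma mean_diff: "mean (x - y) = mean x - mean y"
  and mean_scaleR: "mean (c *\<^sub>R x) = c * mean x"
  by (simp_all add: mean_def inner_diff diff_divide_distrib)

lemma one_inner_one: "(1 :: real ^ 'n) \<bullet> 1 = real CARD('n)"
  by (simp add: inner_vec_def)

lemma mean_one: "mean 1 = 1"
  by (simp add: mean_def one_inner_one)

lemma abs_mean_le_norm: "\<bar>mean x\<bar> \<le> norm x"
proof -
  have "\<bar>x \<bullet> 1\<bar> \<le> (\<Sum>i\<in>UNIV. \<bar>x $ i\<bar>)"
    by (simp add: inner_vec_def sum_abs)
  also have "\<dots> \<le> real CARD('n) * norm x"
    by (rule sum_bounded_above) (rule component_le_norm_cart)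
  finally show ?thesis by (simp add: mean_def abs_divide divide_le_eq mult.commute)
qed

lemma mean_pos: "x \<in> pos_orthant \<Longrightarrow> 0 < mean x"
  by (auto simp: mean_def inner_vec_def pos_orthant_def intro!: divide_pos_pos sum_pos)

text \<open>First-order expansion of \<open>G\<close> at \<open>1\<close>. Pairing with
  \<open>y\<close> removes the component along \<open>1\<close>, and half of the contraction rate is
  given up to absorb the errors.\<close>

lemma local_estimate:
  assumes "0 < \<kappa>"
  obtains \<eta> where "0 < \<eta>" "\<eta> < 1"
    "\<And>y. y \<bullet> 1 = 0 \<Longrightarrow> norm y < \<eta> \<Longrightarrow> \<bar>mean (G (1 + y)) - \<beta>\<bar> \<le> \<kappa>"
    "\<And>y. y \<bullet> 1 = 0 \<Longrightarrow> norm y < \<eta> \<Longrightarrow>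
      y \<bullet> G (1 + y) - mean (G (1 + y)) * (y \<bullet> y) \<le> - (\<delta> / 2) * (y \<bullet> y)"
proof -
  \<comment> \<open>One \<open>\<epsilon>\<close> pays for the remainder of the expansion and one
    for replacing the mean of \<open>G\<close> by \<open>\<beta>\<close>; together they cost at most
    \<open>\<delta> / 2\<close>.\<close>
  define \<epsilon> where "\<epsilon> = min \<kappa> (\<delta> / 4)"
  have \<epsilon>: "0 < \<epsilon>" "\<epsilon> \<le> \<kappa>" "\<epsilon> \<le> \<delta> / 4" using assms delta_pos by (auto simp: \<epsilon>_def)
  have "isCont G 1" using deriv_one by (rule has_derivative_continuous)
  then obtain d1 where d1: "0 < d1" "\<And>x. dist x 1 < d1 \<Longrightarrow> dist (G x) (G 1) < \<epsilon>"
    using \<epsilon>(1) unfolding continuous_at_eps_delta by blast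
  obtain d2 where d2: "0 < d2"
    "\<And>x. norm (x - 1) < d2 \<Longrightarrow> norm (G x - G 1 - D (x - 1)) \<le> \<epsilon> * norm (x - 1)"
    using deriv_one \<epsilon>(1) unfolding has_derivative_at_alt by metis
  show ?thesis
  proof
    show "0 < min (1/2) (min d1 d2)" using d1 d2 by simp
    show "min (1/2) (min d1 d2) < 1" by simp
    fix y :: "real ^ 'n" assume y1: "y \<bullet> 1 = 0" and y: "norm y < min (1/2) (min d1 d2)"
    have "norm (G (1 + y) - \<beta> *\<^sub>R 1) < \<epsilon>"
      using d1(2)[of "1 + y"] y by (simp add: dist_norm G_one)
    moreover have "\<bar>mean (G (1 + y)) - \<beta>\<bar> \<le> norm (G (1 + y) - \<beta> *\<^sub>R 1)"
      using abs_mean_le_norm[of "G (1 + y) - \<beta> *\<^sub>R 1"] by (simp add: mean_diff mean_scaleR mean_one)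
    ultimately have m: "\<bar>mean (G (1 + y)) - \<beta>\<bar> \<le> \<epsilon>" by simp
    with \<epsilon> show "\<bar>mean (G (1 + y)) - \<beta>\<bar> \<le> \<kappa>" by simp
    define \<rho> where "\<rho> = G (1 + y) - G 1 - D y"
    have "norm \<rho> \<le> \<epsilon> * norm y" using d2(2)[of "1 + y"] y by (simp add: \<rho>_def)
    then have "norm y * norm \<rho> \<le> norm y * (\<epsilon> * norm y)" by (rule mult_left_mono) simp
    then have \<rho>: "y \<bullet> \<rho> \<le> \<epsilon> * (y \<bullet> y)"
      using norm_cauchy_schwarz[of y \<rho>] by (simp add: dot_square_norm power2_eq_square mult_ac)
    have "G (1 + y) = \<beta> *\<^sub>R 1 + D y + \<rho>" by (simp add: \<rho>_def G_one)
    then have "y \<bullet> G (1 + y) = y \<bullet> D y + y \<bullet> \<rho>" using y1 by (simp add: inner_add)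
    moreover have "- mean (G (1 + y)) * (y \<bullet> y) \<le> (\<epsilon> - \<beta>) * (y \<bullet> y)"
      using m by (intro mult_right_mono) auto
    moreover have "2 * \<epsilon> * (y \<bullet> y) \<le> (\<delta> / 2) * (y \<bullet> y)"
      using \<epsilon> by (intro mult_right_mono) auto
    ultimately show "y \<bullet> G (1 + y) - mean (G (1 + y)) * (y \<bullet> y) \<le> - (\<delta> / 2) * (y \<bullet> y)"
      using \<rho> contracting[OF y1] by (simp add: algebra_simps)
  qed
qed

end

text \<open>Follows a single trajectory, with the radius and tolerance of
  \<open>local_estimate\<close> fixed. The last assumption is the bound \<open>\<eta>\<close> on the
  initial relative deviation, multiplied by the mean.\<close>

locale trapped_solution = homogeneous_field +
  fixes I :: "real set" and z :: "real \<Rightarrow> real ^ 'n" and \<eta> \<kappa> :: real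
  assumes maximal: "maximal_solution_on G pos_orthant I z"
    and eta: "0 < \<eta>" "\<eta> < 1"
    and mean_G_near: "y \<bullet> 1 = 0 \<Longrightarrow> norm y < \<eta> \<Longrightarrow> \<bar>mean (G (1 + y)) - \<beta>\<bar> \<le> \<kappa>"
    and contracting_near: "y \<bullet> 1 = 0 \<Longrightarrow> norm y < \<eta> \<Longrightarrow>
      y \<bullet> G (1 + y) - mean (G (1 + y)) * (y \<bullet> y) \<le> - (\<delta> / 2) * (y \<bullet> y)"
    and initial: "norm (z 0 - mean (z 0) *\<^sub>R 1) < \<eta> * mean (z 0)"
begin

definition r where "r t = mean (z t)"
definition y where "y t = (1 / r t) *\<^sub>R z t - 1"
definition W where "W t = y t \<bullet> y t"

section \<open>Evolution of the mean and of the relative deviation\<close>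

lemma solution: "solution_on G pos_orthant I z"
  using maximal by (simp add: maximal_solution_on_def)

lemma zero_mem: "0 \<in> I"
  using solution by (simp add: solution_on_def)

lemma Icc_subset: "T \<in> I \<Longrightarrow> {0..T} \<subseteq> I"
  using solution unfolding solution_on_def is_interval_1 by auto

lemma nonneg: "t \<in> I \<Longrightarrow> 0 \<le> t"
  using solution by (auto simp: solution_on_def)

lemma z_pos: "t \<in> I \<Longrightarrow> z t \<in> pos_orthant"
  using solution by (auto simp: solution_on_def)

lemma r_pos: "t \<in> I \<Longrightarrow> 0 < r t"
  unfolding r_def by (intro mean_pos z_pos)

lemma z_eq: "t \<in> I \<Longrightarrow> z t = r t *\<^sub>R (1 + y t)"
  using r_pos[of t] by (simp add: y_def)

lemma y_orth: "t \<in> I \<Longrightarrow> y t \<bullet> 1 = 0"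
  using r_pos[of t] one_inner_one
  by (simp add: y_def inner_diff r_def mean_def field_simps)

lemma G_z: "t \<in> I \<Longrightarrow> G (z t) = G (1 + y t)"
proof -
  assume t: "t \<in> I"
  have "G ((1 / r t) *\<^sub>R z t) = G (z t)"
    using z_pos[OF t] r_pos[OF t] by (intro homogeneous) auto
  then show ?thesis by (simp add: y_def)
qed

lemma continuous_z: "continuous_on I z"
  using solution unfolding solution_on_def
  by (meson continuous_on_vector_derivative)

lemma continuous_r: "continuous_on I r"
  unfolding r_def mean_def by (intro continuous_intros continuous_z) auto

lemma continuous_W: "continuous_on I W"
proof -
  have "\<forall>t\<in>I. r t \<noteq> 0" using r_pos by (metis less_irrefl)
  then show ?thesis
    unfolding W_def y_def by (intro continuous_intros continuous_z continuous_r)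
qed

text \<open>The later time \<open>T\<close> in \<open>I\<close> puts \<open>t\<close> in the
  interior of \<open>I\<close>, where the derivative within \<open>I\<close> is two-sided.\<close>

lemma z_deriv:
  assumes "T \<in> I" "0 < t" "t < T"
  shows "(z has_vector_derivative G (z t)) (at t)"
proof -
  have "{0<..<T} \<subseteq> I" using Icc_subset[OF assms(1)] by auto
  then have "{0<..<T} \<subseteq> interior I" by (rule interior_maximal) simp
  then have t: "t \<in> interior I" using assms by auto
  then have "t \<in> I" using interior_subset by blast
  then have "(z has_vector_derivative G (z t)) (at t within I)"
    using solution unfolding solution_on_def by blast
  then show ?thesis using at_within_interior[OF t] by simp
qed

lemma r_deriv:
  assumes "T \<in> I" "0 < t" "t < T"
  shows "(r has_real_derivative mean (G (1 + y t))) (at t)"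
proof -
  have t: "t \<in> I" using Icc_subset[OF assms(1)] assms by auto
  have "bounded_linear mean"
    unfolding mean_def[abs_def] divide_inverse
    by (intro bounded_linear_mult_const bounded_linear_inner_left)
  from bounded_linear.has_vector_derivative[OF this z_deriv[OF assms]]
  show ?thesis
    by (simp add: r_def[abs_def] has_real_derivative_iff_has_vector_derivative G_z[OF t])
qed

text \<open>The quotient rule gives \<open>y' = (g - m (1 + y)) / r\<close> with
  \<open>g = G (1 + y)\<close> and \<open>m\<close> its mean; pairing with \<open>y\<close> drops
  the component along \<open>1\<close>.\<close>

lemma W_deriv:
  assumes "T \<in> I" "0 < t" "t < T"
  shows "(W has_real_derivative
    2 / r t * (y t \<bullet> G (1 + y t) - mean (G (1 + y t)) * (y t \<bullet> y t))) (at t)"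
proof -
  have t: "t \<in> I" using Icc_subset[OF assms(1)] assms by auto
  let ?g = "G (1 + y t)" and ?m = "mean (G (1 + y t))"
  have r0: "r t \<noteq> 0" using r_pos[OF t] by simp
  have dz: "(z has_vector_derivative ?g) (at t)" using z_deriv[OF assms] G_z[OF t] by simp
  have "((\<lambda>t. 1 / r t) has_real_derivative - ?m / (r t)\<^sup>2) (at t)"
    using r0 by (auto intro!: derivative_eq_intros r_deriv[OF assms] simp: power2_eq_square)
  then have "(y has_vector_derivative (1 / r t) *\<^sub>R ?g + (- ?m / (r t)\<^sup>2) *\<^sub>R z t - 0) (at t)"
    unfolding y_def[abs_def] using dz[unfolded y_def]
    by (intro has_vector_derivative_diff has_vector_derivative_scaleR has_vector_derivative_const)
  moreover have "(1 / r t) *\<^sub>R ?g + (- ?m / (r t)\<^sup>2) *\<^sub>R z t - 0 =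
    (1 / r t) *\<^sub>R (?g - ?m *\<^sub>R (1 + y t))"
    using r0 by (subst z_eq[OF t]) (simp add: power2_eq_square algebra_simps)
  ultimately have dy: "(y has_vector_derivative (1 / r t) *\<^sub>R (?g - ?m *\<^sub>R (1 + y t))) (at t)"
    by simp
  have "(W has_vector_derivative 2 * (y t \<bullet> ((1 / r t) *\<^sub>R (?g - ?m *\<^sub>R (1 + y t))))) (at t)"
    using bounded_bilinear.has_vector_derivative[OF bounded_bilinear_inner dy dy]
    unfolding W_def[abs_def] by (simp add: inner_commute)
  moreover have "2 * (y t \<bullet> ((1 / r t) *\<^sub>R (?g - ?m *\<^sub>R (1 + y t)))) =
    2 / r t * (y t \<bullet> ?g - ?m * (y t \<bullet> y t))"
    using y_orth[OF t] by (simp add: inner_diff inner_add algebra_simps)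
  ultimately show ?thesis by (simp only: has_real_derivative_iff_has_vector_derivative)
qed

lemma W_deriv_le:
  assumes "T \<in> I" "0 < t" "t < T" and small: "W t < \<eta>\<^sup>2"
  obtains d where "(W has_real_derivative d) (at t)" "d \<le> - (\<delta> / r t) * W t"
proof
  have t: "t \<in> I" using Icc_subset[OF assms(1)] assms by auto
  have "norm (y t) < \<eta>"
    using small eta by (simp add: W_def dot_square_norm power2_less_imp_less)
  from contracting_near[OF y_orth[OF t] this]
  have "2 / r t * (y t \<bullet> G (1 + y t) - mean (G (1 + y t)) * (y t \<bullet> y t)) \<le>
    2 / r t * (- (\<delta> / 2) * (y t \<bullet> y t))"
    using r_pos[OF t] by (intro mult_left_mono) auto
  then show "2 / r t * (y t \<bullet> G (1 + y t) - mean (G (1 + y t)) * (y t \<bullet> y t)) \<le> - (\<delta> / r t) * W t"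
    by (simp add: W_def)
qed (rule W_deriv[OF assms(1-3)])

lemma W_initial: "W 0 < \<eta>\<^sup>2"
proof -
  have "z 0 - mean (z 0) *\<^sub>R 1 = r 0 *\<^sub>R y 0"
    using r_pos[OF zero_mem] by (simp add: y_def algebra_simps flip: r_def)
  then have "r 0 * norm (y 0) < \<eta> * r 0"
    using initial r_pos[OF zero_mem] by (simp flip: r_def)
  then have "norm (y 0) < \<eta>" using r_pos[OF zero_mem] by (simp add: mult.commute)
  then show ?thesis unfolding W_def dot_square_norm by (intro power_strict_mono) auto
qed

text \<open>Closes the bootstrap: the decay of \<open>W\<close> is known only while \<open>W\<close>
  is below \<open>\<eta>\<^sup>2\<close>, and \<open>sublevel_trap\<close> shows that it never gets
  there.\<close>

lemma W_bound:
  assumes T: "T \<in> I"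
  shows "W T < \<eta>\<^sup>2"
proof -
  have "W T \<le> W 0"
  proof (rule sublevel_trap[where M = "\<eta>\<^sup>2"])
    show "continuous_on {0..T} W" using continuous_W Icc_subset[OF T] by (rule continuous_on_subset)
    fix t assume t: "0 < t" "t < T" "W t < \<eta>\<^sup>2"
    from T this obtain d where d: "(W has_real_derivative d) (at t)" "d \<le> - (\<delta> / r t) * W t"
      by (rule W_deriv_le)
    have "0 < r t" using Icc_subset[OF T] t by (intro r_pos) auto
    then have "0 \<le> (\<delta> / r t) * W t" using delta_pos by (simp add: W_def)
    with d show "\<exists>d. (W has_real_derivative d) (at t) \<and> d \<le> 0" by force
  qed (use nonneg[OF T] W_initial in auto)
  then show ?thesis using W_initial by simp
qed

lemma norm_y_bound: "t \<in> I \<Longrightarrow> norm (y t) < \<eta>"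
  using W_bound[of t] eta by (simp add: W_def dot_square_norm power2_less_imp_less)

lemma mean_G_bound: "t \<in> I \<Longrightarrow> \<bar>mean (G (1 + y t)) - \<beta>\<bar> \<le> \<kappa>"
  by (intro mean_G_near y_orth norm_y_bound)

section \<open>Linear bounds on the mean, extinction and growth\<close>

lemma r_upper:
  assumes T: "T \<in> I"
  shows "r T \<le> r 0 + (\<beta> + \<kappa>) * T"
proof -
  have "r T - (\<beta> + \<kappa>) * T \<le> r 0 - (\<beta> + \<kappa>) * 0"
  proof (rule DERIV_nonpos_imp_decreasing_open[of 0 T "\<lambda>t. r t - (\<beta> + \<kappa>) * t"])
    show "continuous_on {0..T} (\<lambda>t. r t - (\<beta> + \<kappa>) * t)"
      by (intro continuous_intros continuous_on_subset[OF continuous_r] Icc_subset T)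
    fix t assume t: "0 < t" "t < T"
    have "((\<lambda>t. r t - (\<beta> + \<kappa>) * t) has_real_derivative mean (G (1 + y t)) - (\<beta> + \<kappa>)) (at t)"
      by (auto intro!: derivative_eq_intros r_deriv[OF T t])
    moreover have "\<bar>mean (G (1 + y t)) - \<beta>\<bar> \<le> \<kappa>"
      using Icc_subset[OF T] t by (intro mean_G_bound) auto
    ultimately show "\<exists>d. ((\<lambda>t. r t - (\<beta> + \<kappa>) * t) has_real_derivative d) (at t) \<and> d \<le> 0"
      by force
  qed (use nonneg[OF T] in auto)
  then show ?thesis by simp
qed

lemma r_lower:
  assumes T: "T \<in> I"
  shows "r 0 + (\<beta> - \<kappa>) * T \<le> r T"
proof -
  have "r 0 - (\<beta> - \<kappa>) * 0 \<le> r T - (\<beta> - \<kappa>) * T"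
  proof (rule DERIV_nonneg_imp_increasing_open[of 0 T "\<lambda>t. r t - (\<beta> - \<kappa>) * t"])
    show "continuous_on {0..T} (\<lambda>t. r t - (\<beta> - \<kappa>) * t)"
      by (intro continuous_intros continuous_on_subset[OF continuous_r] Icc_subset T)
    fix t assume t: "0 < t" "t < T"
    have "((\<lambda>t. r t - (\<beta> - \<kappa>) * t) has_real_derivative mean (G (1 + y t)) - (\<beta> - \<kappa>)) (at t)"
      by (auto intro!: derivative_eq_intros r_deriv[OF T t])
    moreover have "\<bar>mean (G (1 + y t)) - \<beta>\<bar> \<le> \<kappa>"
      using Icc_subset[OF T] t by (intro mean_G_bound) auto
    ultimately show "\<exists>d. ((\<lambda>t. r t - (\<beta> - \<kappa>) * t) has_real_derivative d) (at t) \<and> d \<ge> 0"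
      by force
  qed (use nonneg[OF T] in auto)
  then show ?thesis by simp
qed

text \<open>The bound on the relative deviation survives in the limit. As \<open>\<eta> < 1\<close>,
  a limit with positive mean would have positive coordinates, so a limit outside the orthant has
  mean 0, and the same bound then makes it 0.\<close>

lemma global_or_extinct:
  "I = {0..} \<or> (\<exists>c>0. I = {0..<c} \<and> (z \<longlongrightarrow> 0) (at_left c))"
proof -
  have "I = {0..} \<or> (\<exists>c>0. \<exists>zc. I = {0..<c} \<and> (z \<longlongrightarrow> zc) (at_left c) \<and> zc \<notin> pos_orthant)"
    using lipschitz bounded maximal by (rule maximal_solution_dichotomy)
  moreover have "zc = 0"
    if c: "0 < c" and I: "I = {0..<c}" and lim: "(z \<longlongrightarrow> zc) (at_left c)"
      and zc: "zc \<notin> pos_orthant" for c zc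
  proof -
    have "((\<lambda>t. mean (z t)) \<longlongrightarrow> mean zc) (at_left c)"
      unfolding mean_def by (intro tendsto_intros lim) auto
    note limits = this lim
    have "\<forall>\<^sub>F t in at_left c. t \<in> {0<..<c}"
      using c by (intro eventually_at_left_real)
    then have "\<forall>\<^sub>F t in at_left c. norm (z t - mean (z t) *\<^sub>R 1) \<le> \<eta> * mean (z t)"
    proof eventually_elim
      case (elim t)
      then have t: "t \<in> I" using I by auto
      have "z t - mean (z t) *\<^sub>R 1 = r t *\<^sub>R y t"
        using r_pos[OF t] by (simp add: y_def algebra_simps flip: r_def)
      then show ?case
        using norm_y_bound[OF t] r_pos[OF t] by (simp add: mult.commute flip: r_def)
    qed
    then have le: "norm (zc - mean zc *\<^sub>R 1) \<le> \<eta> * mean zc"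
      by (intro tendsto_le[OF _ _ tendsto_norm])
         (auto intro!: tendsto_intros limits simp: trivial_limit_at_left_real)
    have "0 \<le> \<eta> * mean zc" using le norm_ge_zero order_trans by blast
    then have m0: "0 \<le> mean zc" using eta by (simp add: zero_le_mult_iff)
    have "mean zc = 0"
    proof (rule ccontr)
      assume "mean zc \<noteq> 0"
      with m0 have m: "0 < mean zc" by simp
      have "0 < zc $ i" for i
      proof -
        have "mean zc - zc $ i \<le> norm (zc - mean zc *\<^sub>R 1)"
          using component_le_norm_cart[of "zc - mean zc *\<^sub>R 1" i] by simp
        also have "\<dots> \<le> \<eta> * mean zc" by (rule le)
        also have "\<dots> < 1 * mean zc" using m eta by (intro mult_strict_right_mono) auto
        finally show ?thesis by simp
      qed
      with zc show False by (simp add: pos_orthant_def)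
    qed
    with le show ?thesis by simp
  qed
  ultimately show ?thesis by metis
qed

lemma extinct:
  assumes "\<beta> + \<kappa> < 0"
  shows "\<exists>c>0. I = {0..<c} \<and> (z \<longlongrightarrow> 0) (at_left c)"
proof -
  have "I \<noteq> {0..}"
  proof
    assume I: "I = {0..}"
    \<comment> \<open>The zero of the affine upper bound for \<open>r\<close>, at which a global
      solution would lose positivity.\<close>
    define T where "T = r 0 / - (\<beta> + \<kappa>)"
    have T: "T \<in> I" using I assms r_pos[OF zero_mem] by (simp add: T_def divide_nonneg_neg)
    have "r T \<le> r 0 + (\<beta> + \<kappa>) * T" using T by (rule r_upper)
    also have "\<dots> = 0" using assms by (simp add: T_def field_simps)
    finally show False using r_pos[OF T] by simp
  qed
  with global_or_extinct show ?thesis by blast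
qed

text \<open>Extinction would send the mean to 0, whereas the lower bound keeps it above its initial
  value.\<close>

lemma global:
  assumes "0 < \<beta> - \<kappa>"
  shows "I = {0..}"
proof (rule ccontr)
  assume "I \<noteq> {0..}"
  with global_or_extinct obtain c where c: "0 < c" "I = {0..<c}" "(z \<longlongrightarrow> 0) (at_left c)" by blast
  have "((\<lambda>t. mean (z t)) \<longlongrightarrow> mean 0) (at_left c)"
    unfolding mean_def by (intro tendsto_intros c(3)) auto
  moreover have "\<forall>\<^sub>F t in at_left c. r 0 \<le> mean (z t)"
    using eventually_at_left_real[OF c(1)]
  proof eventually_elim
    case (elim t)
    then have t: "t \<in> I" using c by auto
    have "0 \<le> (\<beta> - \<kappa>) * t" using elim assms by simp
    with r_lower[OF t] show ?case by (simp add: r_def)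
  qed
  ultimately have "r 0 \<le> mean 0"
    by (intro tendsto_lowerbound) (auto simp: trivial_limit_at_left_real)
  then show False using r_pos[OF zero_mem] by (simp add: mean_def)
qed

text \<open>Since \<open>r\<close> tends to infinity and \<open>W * r powr p\<close> does not
  increase, \<open>y\<close> tends to 0; so \<open>G (1 + y)\<close> tends to \<open>G 1\<close>,
  and l'Hospital's rule passes from derivatives to quotients.\<close>

lemma growth_rate:
  assumes \<kappa>: "0 < \<beta> - \<kappa>" "0 \<le> \<kappa>"
  shows "((\<lambda>t. z t $ i / t) \<longlongrightarrow> \<beta>) at_top"
proof -
  have I: "I = {0..}" using \<kappa>(1) by (rule global)
  \<comment> \<open>As \<open>\<beta> + \<kappa>\<close> is at most \<open>2 * \<beta>\<close>, this
    exponent makes the logarithmic growth of \<open>r powr p\<close> at most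
    \<open>\<delta> / r\<close>, the decay rate of \<open>W\<close>.\<close>
  define p where "p = \<delta> / (2 * \<beta>)"
  have \<beta>: "0 < \<beta>" using \<kappa> by simp
  have p: "0 < p" using delta_pos \<beta> by (simp add: p_def)
  have r_top: "filterlim r at_top at_top"
  proof (rule filterlim_at_top_mono)
    show "filterlim (\<lambda>t. r 0 + (\<beta> - \<kappa>) * t) at_top at_top"
      using \<kappa>(1) by (intro filterlim_tendsto_add_at_top[OF tendsto_const]
          filterlim_tendsto_pos_mult_at_top[OF tendsto_const] filterlim_ident)
    show "\<forall>\<^sub>F t in at_top. r 0 + (\<beta> - \<kappa>) * t \<le> r t"
      using eventually_ge_at_top[of 0] by eventually_elim (use r_lower I in auto)
  qed
  define C where "C = W 0 * r 0 powr p"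
  have decay: "W T * r T powr p \<le> C" if T0: "0 \<le> T" for T
    unfolding C_def
  proof (rule DERIV_nonpos_imp_decreasing_open[of 0 T "\<lambda>t. W t * r t powr p"])
    have T: "T \<in> I" using I T0 by simp
    show "continuous_on {0..T} (\<lambda>t. W t * r t powr p)"
      using r_pos I by (intro continuous_intros continuous_on_subset[OF continuous_W]
          continuous_on_subset[OF continuous_r]) force+
    fix t assume t: "0 < t" "t < T"
    then have tI: "t \<in> I" using I by simp
    have rt: "0 < r t" using tI by (rule r_pos)
    let ?m = "mean (G (1 + y t))"
    from T t W_bound[OF tI] obtain d
      where d: "(W has_real_derivative d) (at t)" "d \<le> - (\<delta> / r t) * W t"
      by (rule W_deriv_le)
    have W0: "0 \<le> W t" by (simp add: W_def)
    have "((\<lambda>t. W t * r t powr p) has_real_derivative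
      d * r t powr p + W t * (p * r t powr (p - 1) * ?m)) (at t)"
      using rt by (auto intro!: derivative_eq_intros d r_deriv[OF T t])
    moreover have "d * r t powr p + W t * (p * r t powr (p - 1) * ?m) \<le> 0"
    proof -
      have "?m \<le> \<beta> + \<kappa>" using mean_G_bound[OF tI] by simp
      then have "p * ?m \<le> p * (2 * \<beta>)" using p \<kappa> by (intro mult_left_mono) auto
      also have "\<dots> = \<delta>" using \<beta> by (simp add: p_def)
      finally have pm: "p * ?m \<le> \<delta>" .
      have "d * r t powr p \<le> - (\<delta> / r t) * W t * r t powr p"
        using d by (intro mult_right_mono) auto
      also have "\<dots> = - \<delta> * (W t * r t powr (p - 1))"
        using rt by (simp add: powr_diff)
      finally have "d * r t powr p + W t * (p * r t powr (p - 1) * ?m) \<le>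
        (p * ?m - \<delta>) * (W t * r t powr (p - 1))"
        by (simp add: algebra_simps)
      also have "\<dots> \<le> 0" using pm W0 by (intro mult_nonpos_nonneg) auto
      finally show ?thesis .
    qed
    ultimately show "\<exists>d. ((\<lambda>t. W t * r t powr p) has_real_derivative d) (at t) \<and> d \<le> 0" by blast
  qed (rule T0)
  have "(W \<longlongrightarrow> 0) at_top"
  proof (rule tendsto_sandwich[where f = "\<lambda>_. 0" and h = "\<lambda>t. C * r t powr (- p)"])
    show "((\<lambda>t. C * r t powr (- p)) \<longlongrightarrow> 0) at_top"
      using p r_top by (intro tendsto_mult_right_zero tendsto_neg_powr) auto
    show "\<forall>\<^sub>F t in at_top. W t \<le> C * r t powr (- p)"
      using eventually_ge_at_top[of 0]
    proof eventually_elim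
      case (elim t)
      have "0 < r t powr p" using r_pos[of t] I elim by simp
      then show ?case using decay[OF elim] by (simp add: powr_minus field_simps)
    qed
  qed (auto simp: W_def)
  then have "((\<lambda>t. sqrt (W t)) \<longlongrightarrow> sqrt 0) at_top" by (rule tendsto_real_sqrt)
  then have "(y \<longlongrightarrow> 0) at_top"
    by (simp add: W_def tendsto_norm_zero_iff flip: norm_eq_sqrt_inner)
  then have "((\<lambda>t. 1 + y t) \<longlongrightarrow> 1 + 0) at_top" by (intro tendsto_intros)
  moreover have "isCont G (1 + 0)" using deriv_one by (auto intro: has_derivative_continuous)
  ultimately have "((\<lambda>t. G (1 + y t)) \<longlongrightarrow> G (1 + 0)) at_top"
    by (rule isCont_tendsto_compose[rotated])
  from tendsto_vec_nth[OF this, of i]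
  have lim: "((\<lambda>t. G (1 + y t) $ i / 1) \<longlongrightarrow> \<beta>) at_top" by (simp add: G_one)
  show ?thesis
  proof (rule lhospital_at_top_at_top[OF _ _ _ _ lim])
    show "\<forall>\<^sub>F t in at_top. ((\<lambda>t. z t $ i) has_real_derivative G (1 + y t) $ i) (at t)"
      using eventually_gt_at_top[of 0]
    proof eventually_elim
      case (elim t)
      then have "(z has_vector_derivative G (z t)) (at t)"
        using I by (intro z_deriv[of "t + 1"]) auto
      then have "((\<lambda>t. z t $ i) has_vector_derivative G (z t) $ i) (at t)"
        by (rule bounded_linear.has_vector_derivative[OF bounded_linear_vec_nth])
      then show ?case
        using G_z[of t] I elim by (simp add: has_real_derivative_iff_has_vector_derivative)
    qed
  qed (auto simp: filterlim_ident)
qed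

end

section \<open>From the cone condition to trapped trajectories\<close>

context homogeneous_field
begin

text \<open>On the orthant the l1 norm is \<open>CARD('n)\<close> times the mean, and it dominates
  the Euclidean norm; this translates the cone into the Euclidean deviation used for
  trapping.\<close>

lemma cone_nbhd_mean:
  assumes "x \<in> cone_nbhd u"
  shows "x \<in> pos_orthant" "norm (x - mean x *\<^sub>R 1) \<le> real CARD('n) * u * mean x"
proof -
  let ?K = "real CARD('n)"
  show pos: "x \<in> pos_orthant" using assms by (simp add: cone_nbhd_def)
  have m: "0 < mean x" using pos by (rule mean_pos)
  have l1: "l1_norm x = ?K * mean x"
    using pos by (simp add: l1_norm_def mean_def inner_vec_def pos_orthant_def abs_of_pos)
  have "x - mean x *\<^sub>R 1 = l1_norm x *\<^sub>R ((1 / l1_norm x) *\<^sub>R x - (\<chi> i. 1 / ?K))"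
    using m unfolding l1 by (simp add: vec_eq_iff field_simps)
  also have "norm \<dots> = l1_norm x * norm ((1 / l1_norm x) *\<^sub>R x - (\<chi> i. 1 / ?K))"
    using m unfolding l1 by simp
  also have "\<dots> \<le> l1_norm x * l1_norm ((1 / l1_norm x) *\<^sub>R x - (\<chi> i. 1 / ?K))"
    using m unfolding l1
    by (intro mult_left_mono) (simp_all only: l1_norm_def norm_le_l1_cart, simp)
  also have "\<dots> \<le> l1_norm x * u"
    using m assms unfolding l1 by (intro mult_left_mono) (simp_all add: cone_nbhd_def l1)
  finally show "norm (x - mean x *\<^sub>R 1) \<le> ?K * u * mean x" by (simp add: l1 mult_ac)
qed

theorem cone_dichotomy:
  "\<exists>u>0. \<forall>I z. maximal_solution_on G pos_orthant I z \<and> z 0 \<in> cone_nbhd u \<longrightarrow>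
    (\<beta> < 0 \<longrightarrow> (\<exists>c>0. I = {0..<c} \<and> (z \<longlongrightarrow> 0) (at_left c))) \<and>
    (\<beta> > 0 \<longrightarrow> I = {0..} \<and> (\<forall>i. ((\<lambda>t. z t $ i / t) \<longlongrightarrow> \<beta>) at_top))"
proof -
  \<comment> \<open>Half of the modulus keeps \<open>\<beta> + \<kappa>\<close> negative or
    \<open>\<beta> - \<kappa>\<close> positive, according to the sign of \<open>\<beta>\<close>. For
    \<open>\<beta> = 0\<close> nothing is claimed, and 1 is a placeholder.\<close>
  define \<kappa> where "\<kappa> = (if \<beta> = 0 then 1 else \<bar>\<beta>\<bar> / 2)"
  have \<kappa>: "0 < \<kappa>" by (simp add: \<kappa>_def)
  from \<kappa> obtain \<eta> where eta: "0 < \<eta>" "\<eta> < 1"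
    and near: "\<And>y. y \<bullet> 1 = 0 \<Longrightarrow> norm y < \<eta> \<Longrightarrow> \<bar>mean (G (1 + y)) - \<beta>\<bar> \<le> \<kappa>"
      "\<And>y. y \<bullet> 1 = 0 \<Longrightarrow> norm y < \<eta> \<Longrightarrow>
        y \<bullet> G (1 + y) - mean (G (1 + y)) * (y \<bullet> y) \<le> - (\<delta> / 2) * (y \<bullet> y)"
    by (rule local_estimate) (rule that)
  \<comment> \<open>Chosen before any solution is fixed; the factor 2 makes the initial deviation
    strictly smaller than \<open>\<eta>\<close> times the mean.\<close>
  define u where "u = \<eta> / (2 * real CARD('n))"
  have "(\<beta> < 0 \<longrightarrow> (\<exists>c>0. I = {0..<c} \<and> (z \<longlongrightarrow> 0) (at_left c))) \<and>
    (\<beta> > 0 \<longrightarrow> I = {0..} \<and> (\<forall>i. ((\<lambda>t. z t $ i / t) \<longlongrightarrow> \<beta>) at_top))"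
    if max: "maximal_solution_on G pos_orthant I z" and z0: "z 0 \<in> cone_nbhd u" for I z
  proof -
    have "norm (z 0 - mean (z 0) *\<^sub>R 1) \<le> real CARD('n) * u * mean (z 0)"
      using z0 by (rule cone_nbhd_mean)
    also have "\<dots> = \<eta> / 2 * mean (z 0)" by (simp add: u_def)
    also have "\<dots> < \<eta> * mean (z 0)"
      using eta mean_pos[OF cone_nbhd_mean(1)[OF z0]] by (intro mult_strict_right_mono) auto
    finally interpret trapped_solution G D \<beta> \<delta> B I z \<eta> \<kappa>
      using max eta near by unfold_locales auto
    show ?thesis
      using extinct global growth_rate by (auto simp: \<kappa>_def abs_if)
  qed
  moreover have "0 < u" using eta by (simp add: u_def)
  ultimately show ?thesis by blast
qed

end


section \<open>The vector field of the graph\<close>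

lemma abs_exp_minus_diff_le:
  fixes a b :: real
  assumes "0 \<le> a" "0 \<le> b"
  shows "\<bar>exp (- a) - exp (- b)\<bar> \<le> \<bar>a - b\<bar>"
proof -
  have *: "exp (- p) - exp (- q) \<le> q - p" if "0 \<le> p" "p \<le> q" for p q :: real
  proof -
    have "exp (- p) - exp (- q) = exp (- p) * (1 - exp (- (q - p)))"
      by (simp add: algebra_simps flip: exp_add)
    also have "\<dots> \<le> 1 * (q - p)"
    proof (rule mult_mono)
      show "1 - exp (- (q - p)) \<le> q - p" using exp_ge_add_one_self[of "- (q - p)"] by linarith
    qed (use that in auto)
    finally show ?thesis by simp
  qed
  show ?thesis using *[of a b] *[of b a] assms by (cases "a \<le> b") auto
qed

lemma has_derivative_vec_lambda:
  fixes f :: "'a::real_normed_vector \<Rightarrow> real ^ 'n::finite"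
  assumes "\<And>i. ((\<lambda>x. f x $ i) has_derivative (\<lambda>h. f' h $ i)) (at x within X)"
  shows "(f has_derivative f') (at x within X)"
  unfolding has_derivative_componentwise_within[of f]
  using assms by (auto simp: Basis_vec_def inner_axis)

context connected_regular_graph
begin

definition G where "G lam x = drift E lam (phi E x)"

definition S :: "'n \<Rightarrow> real ^ 'n \<Rightarrow> real" where "S i x = (\<Sum>j\<in>closed_nbhd E i. x $ j)"

lemma phi_nth: "phi E x $ i = x $ i / S i x"
  by (simp add: phi_def S_def)

lemma G_nth: "G lam x $ i = lam - phi E x $ i * exp (- S i (phi E x))"
  by (simp add: G_def drift_def S_def)

lemma mem_closed_nbhd: "i \<in> closed_nbhd E i"
  by (simp add: closed_nbhd_def)

lemma S_eq: "S i x = (A *v x) $ i"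
  by (simp add: S_def A_mult_vec)

lemma S_ge:
  assumes "x \<in> pos_orthant"
  shows "x $ i \<le> S i x"
  unfolding S_def
  using assms mem_closed_nbhd by (intro member_le_sum) (auto simp: pos_orthant_def less_imp_le)

lemma S_pos: "x \<in> pos_orthant \<Longrightarrow> 0 < S i x"
  using S_ge[of x i] by (auto simp: pos_orthant_def intro: less_le_trans)

lemma abs_S_diff_le:
  fixes d :: real
  assumes "\<And>j. \<bar>x $ j - y $ j\<bar> \<le> d"
  shows "\<bar>S i x - S i y\<bar> \<le> V * d"
proof -
  have "\<bar>S i x - S i y\<bar> \<le> (\<Sum>j\<in>closed_nbhd E i. \<bar>x $ j - y $ j\<bar>)"
    unfolding S_def sum_subtractf[symmetric] by (rule sum_abs)
  also have "\<dots> \<le> real (card (closed_nbhd E i)) * d"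
    using assms by (intro sum_bounded_above)
  finally show ?thesis by (simp add: regular)
qed

lemma phi_bounds:
  assumes "x \<in> pos_orthant"
  shows "0 < phi E x $ i" "phi E x $ i \<le> 1"
  using assms S_pos[OF assms, of i] S_ge[OF assms, of i]
  by (auto simp: phi_nth pos_orthant_def)

lemma S_phi_pos: "x \<in> pos_orthant \<Longrightarrow> 0 < S i (phi E x)"
  using phi_bounds by (intro S_pos) (simp add: pos_orthant_def)

lemma G_scaleR: "0 < c \<Longrightarrow> G lam (c *\<^sub>R x) = G lam x"
proof -
  assume "0 < c"
  then have "phi E (c *\<^sub>R x) = phi E x"
    by (simp add: vec_eq_iff phi_nth S_eq matrix_vector_mult_scaleR)
  then show ?thesis by (simp add: G_def)
qed

lemma norm_G_le:
  assumes "x \<in> pos_orthant"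
  shows "norm (G lam x) \<le> real CARD('n) * (\<bar>lam\<bar> + 1)"
proof -
  have "\<bar>G lam x $ i\<bar> \<le> \<bar>lam\<bar> + 1" for i
  proof -
    have "exp (- S i (phi E x)) \<le> 1" using S_phi_pos[OF assms, of i] by simp
    then have "\<bar>phi E x $ i * exp (- S i (phi E x))\<bar> \<le> 1"
      using phi_bounds[OF assms, of i] by (simp add: abs_mult mult_le_one)
    then show ?thesis unfolding G_nth by linarith
  qed
  then have "(\<Sum>i\<in>UNIV. \<bar>G lam x $ i\<bar>) \<le> real CARD('n) * (\<bar>lam\<bar> + 1)"
    by (intro sum_bounded_above)
  with norm_le_l1_cart[of "G lam x"] show ?thesis by simp
qed

text \<open>Over the single denominator \<open>S i x\<close>, the other quotient enters only through
  \<open>phi E y $ i\<close>, which is at most 1; thus a lower bound at \<open>x\<close> alone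
  suffices.\<close>

lemma abs_phi_diff_le:
  assumes x: "x \<in> pos_orthant" and y: "y \<in> pos_orthant" and \<rho>: "0 < \<rho>" "\<rho> \<le> x $ i"
    and d: "\<And>j. \<bar>x $ j - y $ j\<bar> \<le> d"
  shows "\<bar>phi E x $ i - phi E y $ i\<bar> \<le> (1 + V) / \<rho> * d"
proof -
  have pos: "0 < S i x" "0 < S i y" using x y S_pos by auto
  have "phi E x $ i - phi E y $ i = ((x $ i - y $ i) + phi E y $ i * (S i y - S i x)) / S i x"
    using pos by (simp add: phi_nth field_simps)
  then have "\<bar>phi E x $ i - phi E y $ i\<bar> =
    \<bar>(x $ i - y $ i) + phi E y $ i * (S i y - S i x)\<bar> / S i x"
    using pos by simp
  also have "\<dots> \<le> ((1 + V) * d) / \<rho>"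
  proof (rule frac_le)
    have "\<bar>phi E y $ i * (S i y - S i x)\<bar> \<le> 1 * \<bar>S i y - S i x\<bar>"
      unfolding abs_mult using phi_bounds[OF y, of i] by (intro mult_right_mono) auto
    also have "\<dots> \<le> V * d" using abs_S_diff_le[OF d, of i] by (simp add: abs_minus_commute)
    finally show "\<bar>(x $ i - y $ i) + phi E y $ i * (S i y - S i x)\<bar> \<le> (1 + V) * d"
      using d[of i] by (simp add: distrib_right)
    show "\<rho> \<le> S i x" using \<rho> S_ge[OF x, of i] by simp
    show "0 \<le> (1 + V) * d" using d[of i] by (intro mult_nonneg_nonneg) auto
  qed (rule \<rho>)
  finally show ?thesis by simp
qed

lemma G_lipschitz:
  assumes "x0 \<in> pos_orthant"
  shows "\<exists>\<rho>>0. \<exists>L. cball x0 \<rho> \<subseteq> pos_orthant \<and> L-lipschitz_on (cball x0 \<rho>) (G lam)"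
proof -
  \<comment> \<open>Half of the smallest coordinate, so that every coordinate stays at least
    \<open>\<rho>\<close> on the ball.\<close>
  define \<rho> where "\<rho> = Min (range (\<lambda>i. x0 $ i)) / 2"
  have \<rho>: "0 < \<rho>" using assms by (simp add: \<rho>_def pos_orthant_def)
  have "2 * \<rho> \<le> x0 $ i" for i by (simp add: \<rho>_def)
  moreover have "\<bar>x0 $ i - x $ i\<bar> \<le> \<rho>" if "x \<in> cball x0 \<rho>" for x i
    using component_le_norm_cart[of "x0 - x" i] that by (simp add: dist_norm)
  ultimately have ge: "\<rho> \<le> x $ i" if "x \<in> cball x0 \<rho>" for x i
    using that by (smt (verit))
  have sub: "cball x0 \<rho> \<subseteq> pos_orthant"
    using ge \<rho> unfolding pos_orthant_def by (blast intro: less_le_trans)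
  define l where "l = (1 + V) / \<rho>"
  define C where "C = real CARD('n) * (l + V * l)"
  have l: "0 \<le> l" using \<rho> by (simp add: l_def)
  have "C-lipschitz_on (cball x0 \<rho>) (G lam)"
  proof (rule lipschitz_onI)
    fix x y assume xy: "x \<in> cball x0 \<rho>" "y \<in> cball x0 \<rho>"
    then have pos: "x \<in> pos_orthant" "y \<in> pos_orthant" using sub by auto
    define d where "d = norm (x - y)"
    have d: "\<bar>x $ j - y $ j\<bar> \<le> d" for j
      using component_le_norm_cart[of "x - y" j] by (simp add: d_def)
    have ph: "\<bar>phi E x $ j - phi E y $ j\<bar> \<le> l * d" for j
      unfolding l_def using pos \<rho> ge[OF xy(1)] d by (rule abs_phi_diff_le)
    have "\<bar>(G lam x - G lam y) $ i\<bar> \<le> (l + V * l) * d" for i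
    proof -
      let ?p = "phi E x $ i" and ?q = "phi E y $ i"
      let ?e = "exp (- S i (phi E x))" and ?f = "exp (- S i (phi E y))"
      have "\<bar>?f - ?e\<bar> \<le> \<bar>S i (phi E y) - S i (phi E x)\<bar>"
        using S_phi_pos[OF pos(1), of i] S_phi_pos[OF pos(2), of i]
        by (intro abs_exp_minus_diff_le) auto
      also have "\<dots> \<le> V * (l * d)"
        using ph by (intro abs_S_diff_le) (simp add: abs_minus_commute)
      finally have ef: "\<bar>?f - ?e\<bar> \<le> V * l * d" by (simp add: mult_ac)
      \<comment> \<open>The difference of products is split so that each remaining factor,
        \<open>?f\<close> or \<open>?p\<close>, is at most 1.\<close>
      have "(G lam x - G lam y) $ i = (?q - ?p) * ?f + ?p * (?f - ?e)"
        by (simp add: G_nth algebra_simps)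
      also have "\<bar>\<dots>\<bar> \<le> \<bar>?q - ?p\<bar> * ?f + ?p * \<bar>?f - ?e\<bar>"
        using phi_bounds[OF pos(1), of i] abs_triangle_ineq[of "(?q - ?p) * ?f" "?p * (?f - ?e)"]
        by (simp add: abs_mult)
      also have "\<dots> \<le> \<bar>?q - ?p\<bar> * 1 + 1 * \<bar>?f - ?e\<bar>"
        using phi_bounds[OF pos(1), of i] S_phi_pos[OF pos(2), of i]
        by (intro add_mono mult_left_mono mult_right_mono) auto
      also have "\<dots> \<le> l * d + V * l * d"
        using ph[of i] ef by (simp add: abs_minus_commute)
      finally show ?thesis by (simp add: distrib_right)
    qed
    then have "(\<Sum>i\<in>UNIV. \<bar>(G lam x - G lam y) $ i\<bar>) \<le> real CARD('n) * ((l + V * l) * d)"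
      by (intro sum_bounded_above)
    with norm_le_l1_cart[of "G lam x - G lam y"]
    show "dist (G lam x) (G lam y) \<le> C * dist x y"
      by (simp add: dist_norm C_def d_def mult_ac)
  next
    show "0 \<le> C" using l by (simp add: C_def)
  qed
  with \<rho> sub show ?thesis by blast
qed

section \<open>Linearisation at the diagonal\<close>

lemma phi_one: "phi E 1 = (\<chi> i. 1 / V)"
  by (simp add: vec_eq_iff phi_nth S_def regular)

lemma S_phi_one: "S i (phi E 1) = 1"
  using V_pos by (simp add: phi_one S_def regular)

lemma G_one: "G lam 1 = (lam - exp (-1) / V) *\<^sub>R 1"
  by (simp add: vec_eq_iff G_nth S_phi_one, simp add: phi_one)

lemma bounded_linear_S: "bounded_linear (S i)"
  unfolding S_def[abs_def] by (intro bounded_linear_sum bounded_linear_vec_nth)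

text \<open>The chain rule produces \<open>L\<close> twice: \<open>phi\<close> has derivative
  \<open>L / V\<^sup>2\<close> at \<open>1\<close>, and differentiating the outer map where
  \<open>phi\<close> equals \<open>1 / V\<close> gives \<open>- exp (-1) / V\<close> times
  \<open>L\<close> again.\<close>

lemma G_deriv_one: "(G lam has_derivative (\<lambda>h. - (exp (-1) / V ^ 3) *\<^sub>R L (L h))) (at 1)"
proof (rule has_derivative_vec_lambda)
  fix i
  have S1: "S j 1 = V" for j by (simp add: S_def regular)
  have dS: "(S j has_derivative S j) F" for j F
    using bounded_linear_S by (rule bounded_linear_imp_has_derivative)
  have dphi: "((\<lambda>x. phi E x $ j) has_derivative (\<lambda>h. L h $ j / V\<^sup>2)) (at 1)" for j
  proof -
    have "((\<lambda>x. x $ j) has_derivative (\<lambda>h. h $ j)) (at 1)"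
      by (rule bounded_linear_imp_has_derivative) (rule bounded_linear_vec_nth)
    from has_derivative_divide'[OF this dS[of j]]
    have "((\<lambda>x. x $ j / S j x) has_derivative
      (\<lambda>h. (h $ j * S j 1 - 1 $ j * S j h) / (S j 1 * S j 1))) (at 1)"
      using V_pos by (simp add: S1)
    moreover have "(\<lambda>h. (h $ j * S j 1 - 1 $ j * S j h) / (S j 1 * S j 1)) = (\<lambda>h. L h $ j / V\<^sup>2)"
      unfolding S1 by (simp add: L_def S_eq power2_eq_square mult.commute)
    ultimately show ?thesis by (simp add: phi_nth)
  qed
  have dp: "((\<lambda>x. S i (phi E x)) has_derivative (\<lambda>h. S i (L h) / V\<^sup>2)) (at 1)"
    unfolding S_def sum_divide_distrib by (intro has_derivative_sum dphi)
  have "((\<lambda>x. lam - phi E x $ i * exp (- S i (phi E x))) has_derivative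
    (\<lambda>h. 0 - (phi E 1 $ i * (- (S i (L h) / V\<^sup>2) * exp (- S i (phi E 1))) +
       L h $ i / V\<^sup>2 * exp (- S i (phi E 1))))) (at 1)"
    by (intro has_derivative_diff has_derivative_const has_derivative_mult has_derivative_exp
        has_derivative_minus dphi dp)
  moreover have "(\<lambda>h. 0 - (phi E 1 $ i * (- (S i (L h) / V\<^sup>2) * exp (- S i (phi E 1))) +
       L h $ i / V\<^sup>2 * exp (- S i (phi E 1)))) = (\<lambda>h. (- (exp (-1) / V ^ 3) *\<^sub>R L (L h)) $ i)"
  proof
    fix h
    have LL: "L (L h) $ i = V * L h $ i - S i (L h)" by (simp add: L_def[of "L h"] S_eq)
    show "0 - (phi E 1 $ i * (- (S i (L h) / V\<^sup>2) * exp (- S i (phi E 1))) +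
       L h $ i / V\<^sup>2 * exp (- S i (phi E 1))) = (- (exp (-1) / V ^ 3) *\<^sub>R L (L h)) $ i"
      using V_pos unfolding S_phi_one vector_scaleR_component LL
      by (simp add: phi_one field_simps power2_eq_square power3_eq_cube)
  qed
  ultimately show "((\<lambda>x. G lam x $ i) has_derivative
    (\<lambda>h. (- (exp (-1) / V ^ 3) *\<^sub>R L (L h)) $ i)) (at 1)"
    by (simp only: G_nth)
qed

text \<open>By self-adjointness \<open>y \<bullet> L (L y)\<close> is the squared norm of
  \<open>L y\<close>, which the squared spectral gap bounds from below. The resulting contraction
  rate is exactly the excess of \<open>lam\<close> over the threshold.\<close>

lemma homogeneous_field_G:
  assumes "lam > exp (-1) / V * (1 - (spectral_gap A)\<^sup>2 / V\<^sup>2)"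
  shows "homogeneous_field (G lam) (\<lambda>h. - (exp (-1) / V ^ 3) *\<^sub>R L (L h)) (lam - exp (-1) / V)
    (lam - exp (-1) / V * (1 - (spectral_gap A)\<^sup>2 / V\<^sup>2)) (real CARD('n) * (\<bar>lam\<bar> + 1))"
proof
  fix y :: "real ^ 'n" assume y: "y \<bullet> 1 = 0"
  have "(spectral_gap A * norm y)\<^sup>2 \<le> (norm (L y))\<^sup>2"
    using spectral_gap_bound(1) spectral_gap_bound(2)[OF y] by (intro power_mono) auto
  then have "(spectral_gap A)\<^sup>2 * (y \<bullet> y) \<le> L y \<bullet> L y"
    by (simp add: power_mult_distrib dot_square_norm)
  also have "L y \<bullet> L y = y \<bullet> L (L y)" by (simp add: L_self_adjoint)
  finally have "exp (-1) / V ^ 3 * ((spectral_gap A)\<^sup>2 * (y \<bullet> y)) \<le> exp (-1) / V ^ 3 * (y \<bullet> L (L y))"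
    by (intro mult_left_mono) auto
  then show "y \<bullet> (- (exp (-1) / V ^ 3) *\<^sub>R L (L y)) - (lam - exp (-1) / V) * (y \<bullet> y) \<le>
    - (lam - exp (-1) / V * (1 - (spectral_gap A)\<^sup>2 / V\<^sup>2)) * (y \<bullet> y)"
    using V_pos by (simp add: algebra_simps power2_eq_square power3_eq_cube)
qed (use assms G_lipschitz in \<open>simp_all only: G_scaleR norm_G_le G_one G_deriv_one diff_gt_0_iff_gt\<close>)

end

section \<open>Extinction and linear growth for the graph dynamics\<close>

theorem corollary4:
  fixes E :: "('n::finite \<times> 'n) set" and V :: nat and lam :: real
  assumes "CARD('n) \<ge> 2"
    and "sym E" and "irrefl E" and "\<forall>i j. (i, j) \<in> E\<^sup>*"
    and "\<forall>i. card (closed_nbhd E i) = V"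
    and "lam > 0"
    and "lam > exp (-1) / real V * (1 - (spectral_gap (nbhd_matrix E))\<^sup>2 / (real V)\<^sup>2)"
  shows "\<exists>u>0. \<forall>I (z :: real \<Rightarrow> real ^ 'n).
    maximal_solution_on (\<lambda>x. drift E lam (phi E x)) pos_orthant I z \<and> z 0 \<in> cone_nbhd u \<longrightarrow>
      (lam < exp (-1) / real V \<longrightarrow>
         (\<exists>c>0. I = {0..<c} \<and> (z \<longlongrightarrow> 0) (at_left c))) \<and>
      (lam > exp (-1) / real V \<longrightarrow>
         I = {0..} \<and>
         (\<forall>i. ((\<lambda>t. z t $ i / t) \<longlongrightarrow> lam - exp (-1) / real V) at_top))"
proof -
  interpret connected_regular_graph E V
    using assms by unfold_locales auto
  interpret homogeneous_field "G lam" "\<lambda>h. - (exp (-1) / V ^ 3) *\<^sub>R L (L h)" "lam - exp (-1) / V"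
    "lam - exp (-1) / V * (1 - (spectral_gap A)\<^sup>2 / V\<^sup>2)" "real CARD('n) * (\<bar>lam\<bar> + 1)"
    using assms(7) by (intro homogeneous_field_G) simp
  have "G lam = (\<lambda>x. drift E lam (phi E x))" by (simp add: G_def fun_eq_iff)
  with cone_dichotomy show ?thesis by simp
qed

end
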